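(* Let $g\ge2$, let $U=(I_1,\dots,I_{g+1},V_1,\dots,V_{g+1})\in\mathcal U$ be such that the spectral curve $\gamma$ is nonsingular, let $P_1,\dots,P_g\in\gamma$ be the points given by the eigenvector map at $U$, assumed in generic position ($u$-coordinates nonzero and pairwise distinct), and let $A=\bigl(0,\prod_i V_i-\prod_i I_i\bigr)\in\gamma$. Let $Q_1,\dots,Q_g\in\gamma$ be the remaining zeros on $\gamma$ of the function $h_1$ of the context, i.e. $(h_1)=D_Q+D_P+A-P_\infty'-2D^\ast$ with $D_P=\sum P_i$, $D_Q=\sum Q_i$. Let $\bar P_1,\dots,\bar P_g\in\gamma$ be the points given by the eigenvector map at $\bar U=\chi(U)$, which satisfy $D_Q+D_{\bar P}-2D^\ast\equiv0$ modulo principal divisors, $D_{\bar P}=\sum\bar P_i$. (1) If $g$ is even then (after relabelling) $\bar P_i=Q_i'$ for $i=1,\dots,g$, where $(u,v)'=(u,-v)$. (2) If $g$ is odd then $\bar P_1,\dots,\bar P_g$ are, together with $Q_1,\dots,Q_g$, the intersection points of $\gamma$ and the curve $\kappa_2=(h_2(u,v)=0)$ given by $$h_2(u,v)=\sum_{i=0}^{g-1}\bigl(s_1(c_i)+2I_1\acute c_{i+1}\bigr)u^i+c_gu^g+u^{g+1}+v,$$ where $\acute c_i$ is obtained from $c_i$ by setting $I_1=V_1=0$ for $i=1,2,\dots,g$.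
   Context: Periodic discrete Toda lattice: indices mod $g+1$; phase space $\mathcal U=\{(I_1,\dots,I_{g+1},V_1,\dots,V_{g+1})\in\mathbb C^{2g+2}: 0<\prod V_i<\prod I_i\}$; the time evolution $\chi:U\mapsto\bar U$ is $$\bar I_i=V_i+I_i\frac{1-\frac{V_1\cdots V_{g+1}}{I_1\cdots I_{g+1}}}{1+\frac{V_{i-1}}{I_{i-1}}+\frac{V_{i-1}V_{i-2}}{I_{i-1}I_{i-2}}+\cdots+\frac{V_{i-1}\cdots V_{i+1}}{I_{i-1}\cdots I_{i+1}}},\qquad \bar V_i=\frac{I_{i+1}V_i}{\bar I_i},$$ equivalently $\bar I_i+\bar V_{i-1}=I_i+V_i$, $\bar V_i\bar I_i=I_{i+1}V_i$ (on $\mathcal U$). All expressions are assumed to be defined. Lax matrix: $L=(l_{ij})$ is the $(g+1)\times(g+1)$ matrix, depending on a parameter $y$, with diagonal entries $l_{ii}=I_{i+1}+V_i$, superdiagonal entries $1$, subdiagonal entries $l_{i,i-1}=I_iV_i$, upper-right corner $(-1)^gI_1V_1/y$, lower-left corner $(-1)^gy$, all other entries $0$. One has $\tilde f(x,y):=y\det(x\,\mathrm{Id}+L)=y^2+y(x^{g+1}+c_gx^g+\cdots+c_1x+c_0)+c_{-1}$, which defines polynomials $c_{-1},\dots,c_g$ in the $I_i,V_i$; they are conserved by $\chi$. $s_1(c_i)$ is $c_i$ with $I_1$ replaced by $-I_1$; $t_{g+1}(c_i)$ is $c_i$ with $V_{g+1}$ replaced by $-V_{g+1}$. Spectral curve: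 $\gamma$ is the smooth completion of $v^2=(u^{g+1}+c_gu^g+\cdots+c_0)^2-4c_{-1}$ with points at infinity $P_\infty$ ($v/u^{g+1}\to1$), $P_\infty'$ ($v/u^{g+1}\to-1$). The map $\rho(x,y)=(x,y-c_{-1}/y)$ sends $\tilde f=0$ to $\gamma$. $D^\ast=\frac g2(P_\infty+P'_\infty)$ for $g$ even, $D^\ast=\frac{g-1}2(P_\infty+P_\infty')+P_\infty$ for $g$ odd. Eigenvector map: for $i=1,\dots,g$ let $\varphi_i(x,y)$ be the determinant of the $g\times g$ matrix obtained from the upper-left $g\times g$ block of $x\,\mathrm{Id}+L$ by replacing its $i$-th column by $(l_{1,g+1},\dots,l_{g,g+1})^T$. There are exactly $g$ points $\tilde P_i$ (with multiplicity) with $\varphi_1=\varphi_2=0$; they lie on $\tilde f=0$, and their $x$-coordinates are the roots of the determinant of the upper-left $g\times g$ block of $x\,\mathrm{Id}+L$. The points given by the eigenvector map at $U$ are $P_i=\rho(\tilde P_i)\in\gamma$. The function $h_1$: $h_1(u,v)=\sum_{i=0}^gs_1(c_i)u^i+u^{g+1}-v$ for $g$ even, $h_1(u,v)=\sum_{i=0}^gt_{g+1}(c_i)u^i+u^{g+1}+v$ for $g$ odd; it vanishes at $A,P_1,\dots,P_g$ and its poles are bounded by $P'_\infty+2D^\ast$. *)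

theory Defs
  imports
    "Jordan_Normal_Form.Determinant"
    "HOL-Computational_Algebra.Formal_Laurent_Series"
    "HOL-Library.Poly_Mapping"
begin

section \<open>The periodic discrete Toda lattice\<close>

text \<open>
  A state is a pair of functions I, V of type nat to complex, of which only the values at the
  indices 1, ..., g+1 matter. The function below reduces an arbitrary integer index modulo g+1
  to this range.
\<close>

definition wrap :: "nat \<Rightarrow> int \<Rightarrow> nat" where
  "wrap g k = nat ((k - 1) mod (int g + 1)) + 1"

definition phase_space :: "nat \<Rightarrow> ((nat \<Rightarrow> complex) \<times> (nat \<Rightarrow> complex)) set" where
  "phase_space g = {(I, V).
     (\<Prod>i=1..g+1. V i) \<in> \<real> \<and> (\<Prod>i=1..g+1. I i) \<in> \<real> \<and>
     0 < Re (\<Prod>i=1..g+1. V i) \<and> Re (\<Prod>i=1..g+1. V i) < Re (\<Prod>i=1..g+1. I i)}"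

definition toda_denom :: "nat \<Rightarrow> (nat \<Rightarrow> complex) \<Rightarrow> (nat \<Rightarrow> complex) \<Rightarrow> nat \<Rightarrow> complex" where
  "toda_denom g I V i =
     (\<Sum>k=0..g. \<Prod>j=1..k. V (wrap g (int i - int j)) / I (wrap g (int i - int j)))"

definition toda_I :: "nat \<Rightarrow> (nat \<Rightarrow> complex) \<Rightarrow> (nat \<Rightarrow> complex) \<Rightarrow> nat \<Rightarrow> complex" where
  "toda_I g I V i =
     V i + I i * ((1 - (\<Prod>k=1..g+1. V k) / (\<Prod>k=1..g+1. I k)) / toda_denom g I V i)"

definition toda_V :: "nat \<Rightarrow> (nat \<Rightarrow> complex) \<Rightarrow> (nat \<Rightarrow> complex) \<Rightarrow> nat \<Rightarrow> complex" where
  "toda_V g I V i = I (wrap g (int i + 1)) * V i / toda_I g I V i"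

text \<open>
  All expressions in the time evolution are defined. On the phase space the entries of I are
  automatically nonzero.
\<close>

definition toda_defined :: "nat \<Rightarrow> (nat \<Rightarrow> complex) \<Rightarrow> (nat \<Rightarrow> complex) \<Rightarrow> bool" where
  "toda_defined g I V \<longleftrightarrow>
     (\<forall>i\<in>{1..g+1}. toda_denom g I V i \<noteq> 0 \<and> toda_I g I V i \<noteq> 0)"


section \<open>Lax matrix and spectral polynomial\<close>

text \<open>Entries are indexed from 1; library matrices are indexed from 0, hence the shifts.\<close>

definition lax :: "nat \<Rightarrow> (nat \<Rightarrow> complex) \<Rightarrow> (nat \<Rightarrow> complex) \<Rightarrow> complex \<Rightarrow> nat \<Rightarrow> nat \<Rightarrow> complex" where
  "lax g I V y i j =
     (if i = j then I (wrap g (int i + 1)) + V i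
      else if j = i + 1 then 1
      else if i = j + 1 then I i * V i
      else if i = 1 \<and> j = g + 1 then (-1) ^ g * I 1 * V 1 / y
      else if i = g + 1 \<and> j = 1 then (-1) ^ g * y
      else 0)"

definition lax_mat :: "nat \<Rightarrow> (nat \<Rightarrow> complex) \<Rightarrow> (nat \<Rightarrow> complex) \<Rightarrow> complex \<Rightarrow> complex mat" where
  "lax_mat g I V y = mat (g+1) (g+1) (\<lambda>(i, j). lax g I V y (i + 1) (j + 1))"

text \<open>
  The pair consisting of the polynomial x^(g+1) + c_g x^g + ... + c_0 and the number c_(-1).
  The identity, holding for all x and all nonzero y, determines both uniquely. (For g at least 2
  they exist, for all complex values of the I_i and V_i, and depend polynomially on them.)
\<close>

definition spectral_data :: "nat \<Rightarrow> (nat \<Rightarrow> complex) \<Rightarrow> (nat \<Rightarrow> complex) \<Rightarrow> complex poly \<times> complex" where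
  "spectral_data g I V = (THE (p, c). degree p = g + 1 \<and> lead_coeff p = 1 \<and>
     (\<forall>x y. y \<noteq> 0 \<longrightarrow>
        y * det (x \<cdot>\<^sub>m 1\<^sub>m (g+1) + lax_mat g I V y) = y^2 + y * poly p x + c))"

definition c_poly :: "nat \<Rightarrow> (nat \<Rightarrow> complex) \<Rightarrow> (nat \<Rightarrow> complex) \<Rightarrow> complex poly" where
  "c_poly g I V = fst (spectral_data g I V)"

definition c_minus1 :: "nat \<Rightarrow> (nat \<Rightarrow> complex) \<Rightarrow> (nat \<Rightarrow> complex) \<Rightarrow> complex" where
  "c_minus1 g I V = snd (spectral_data g I V)"

definition c_coeff :: "nat \<Rightarrow> (nat \<Rightarrow> complex) \<Rightarrow> (nat \<Rightarrow> complex) \<Rightarrow> nat \<Rightarrow> complex" where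
  "c_coeff g I V i = coeff (c_poly g I V) i"

text \<open>
  Substitutions into the polynomials c_i are expressed as evaluation of the corresponding
  polynomial functions at the modified state.
\<close>

definition s1_c :: "nat \<Rightarrow> (nat \<Rightarrow> complex) \<Rightarrow> (nat \<Rightarrow> complex) \<Rightarrow> nat \<Rightarrow> complex" where
  "s1_c g I V i = c_coeff g (I(1 := - I 1)) V i"

definition t_c :: "nat \<Rightarrow> (nat \<Rightarrow> complex) \<Rightarrow> (nat \<Rightarrow> complex) \<Rightarrow> nat \<Rightarrow> complex" where
  "t_c g I V i = c_coeff g I (V(g+1 := - V (g+1))) i"

definition acute_c :: "nat \<Rightarrow> (nat \<Rightarrow> complex) \<Rightarrow> (nat \<Rightarrow> complex) \<Rightarrow> nat \<Rightarrow> complex" where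
  "acute_c g I V i = c_coeff g (I(1 := 0)) (V(1 := 0)) i"


section \<open>Hyperelliptic curves v^2 = F(u) with F monic of degree 2n\<close>

text \<open>
  The smooth completion has two points at infinity: at \<open>PInf\<close> the function v/u^n has value 1,
  at \<open>PInf'\<close> it has value -1.
\<close>

datatype curve_point = Aff (u_of: complex) (v_of: complex) | PInf | PInf'

definition curve :: "complex poly \<Rightarrow> curve_point set" where
  "curve F = {Aff u v | u v. v^2 = poly F u} \<union> {PInf, PInf'}"

text \<open>
  The partial derivatives of v^2 - F(u) have no common zero on the affine curve; the points at
  infinity of the completion are always smooth.
\<close>

definition nonsingular_curve :: "complex poly \<Rightarrow> bool" where
  "nonsingular_curve F \<longleftrightarrow>
     (\<forall>u v. v^2 = poly F u \<longrightarrow> \<not> (2 * v = 0 \<and> - poly (pderiv F) u = 0))"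

fun hyp_inv :: "curve_point \<Rightarrow> curve_point" where
  "hyp_inv (Aff u v) = Aff u (- v)"
| "hyp_inv PInf = PInf'"
| "hyp_inv PInf' = PInf"

definition fls_eval :: "complex poly \<Rightarrow> complex fls \<Rightarrow> complex fls" where
  "fls_eval p U = poly (map_poly fls_const p) U"

text \<open>
  Formal local parametrisations (U(t), V(t)) of the curve at a point, with t a local uniformiser:
  at an affine point u or v has nonvanishing derivative with respect to t, and at infinity
  1/u has a simple zero.
\<close>

fun local_param :: "complex poly \<Rightarrow> nat \<Rightarrow> curve_point \<Rightarrow> complex fls \<Rightarrow> complex fls \<Rightarrow> bool" where
  "local_param F n (Aff u v) U V \<longleftrightarrow> V^2 = fls_eval F U \<and>
     (\<exists>A B. U = fps_to_fls A \<and> V = fps_to_fls B \<and> fps_nth A 0 = u \<and> fps_nth B 0 = v \<and>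
        (fps_nth A 1 \<noteq> 0 \<or> fps_nth B 1 \<noteq> 0))"
| "local_param F n PInf U V \<longleftrightarrow> V^2 = fls_eval F U \<and> fls_subdegree U = -1 \<and>
     (\<exists>W. V = U^n * fps_to_fls W \<and> fps_nth W 0 = 1)"
| "local_param F n PInf' U V \<longleftrightarrow> V^2 = fls_eval F U \<and> fls_subdegree U = -1 \<and>
     (\<exists>W. V = U^n * fps_to_fls W \<and> fps_nth W 0 = -1)"

text \<open>A triple (a, b, d) with d nonzero stands for the rational function (a(u) + b(u) v) / d(u)
  on the curve; every rational function is of this form.\<close>

type_synonym rat_fun = "complex poly \<times> complex poly \<times> complex poly"

fun expand :: "rat_fun \<Rightarrow> complex fls \<Rightarrow> complex fls \<Rightarrow> complex fls" where
  "expand (a, b, d) U V = (fls_eval a U + fls_eval b U * V) / fls_eval d U"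

definition has_order :: "complex poly \<Rightarrow> nat \<Rightarrow> rat_fun \<Rightarrow> curve_point \<Rightarrow> int \<Rightarrow> bool" where
  "has_order F n f R k \<longleftrightarrow>
     (\<exists>U V. local_param F n R U V \<and> expand f U V \<noteq> 0 \<and> fls_subdegree (expand f U V) = k)"

text \<open>Divisors are elements of the free abelian group on the points.\<close>

type_synonym divisor = "curve_point \<Rightarrow>\<^sub>0 int"

definition has_divisor :: "complex poly \<Rightarrow> nat \<Rightarrow> rat_fun \<Rightarrow> divisor \<Rightarrow> bool" where
  "has_divisor F n f D \<longleftrightarrow> Poly_Mapping.keys D \<subseteq> curve F \<and>
     (\<forall>R\<in>curve F. has_order F n f R (Poly_Mapping.lookup D R))"

definition principal_divisor :: "complex poly \<Rightarrow> nat \<Rightarrow> divisor \<Rightarrow> bool" where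
  "principal_divisor F n D \<longleftrightarrow> (\<exists>a b d. d \<noteq> 0 \<and> has_divisor F n (a, b, d) D)"


section \<open>Spectral curve and eigenvector map\<close>

definition spectral_F :: "nat \<Rightarrow> (nat \<Rightarrow> complex) \<Rightarrow> (nat \<Rightarrow> complex) \<Rightarrow> complex poly" where
  "spectral_F g I V = (c_poly g I V)^2 - [:4 * c_minus1 g I V:]"

definition D_star :: "nat \<Rightarrow> divisor" where
  "D_star g = (if even g
     then frag_cmul (int (g div 2)) (frag_of PInf + frag_of PInf')
     else frag_cmul (int ((g - 1) div 2)) (frag_of PInf + frag_of PInf') + frag_of PInf)"

definition lax_block :: "nat \<Rightarrow> (nat \<Rightarrow> complex) \<Rightarrow> (nat \<Rightarrow> complex) \<Rightarrow> complex \<Rightarrow> complex \<Rightarrow> complex mat" where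
  "lax_block g I V x y = mat g g (\<lambda>(i, j). (x \<cdot>\<^sub>m 1\<^sub>m (g+1) + lax_mat g I V y) $$ (i, j))"

definition phi :: "nat \<Rightarrow> (nat \<Rightarrow> complex) \<Rightarrow> (nat \<Rightarrow> complex) \<Rightarrow> nat \<Rightarrow> complex \<Rightarrow> complex \<Rightarrow> complex" where
  "phi g I V k x y =
     det (replace_col (lax_block g I V x y) (vec g (\<lambda>r. lax g I V y (r + 1) (g + 1))) (k - 1))"

definition rho :: "nat \<Rightarrow> (nat \<Rightarrow> complex) \<Rightarrow> (nat \<Rightarrow> complex) \<Rightarrow> complex \<times> complex \<Rightarrow> curve_point" where
  "rho g I V = (\<lambda>(x, y). Aff x (y - c_minus1 g I V / y))"

text \<open>
  P_1, ..., P_g are the images under \<open>rho\<close> of the common zeros of \<open>phi 1\<close> and \<open>phi 2\<close> on the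
  region where y is nonzero. The multiplicity of a common zero is the multiplicity of its
  x-coordinate as a root of the determinant of the upper-left block of x Id + L (which does not
  depend on y, and at each of whose roots there is exactly one common zero).
\<close>

definition eigenvector_points ::
  "nat \<Rightarrow> (nat \<Rightarrow> complex) \<Rightarrow> (nat \<Rightarrow> complex) \<Rightarrow> (nat \<Rightarrow> curve_point) \<Rightarrow> bool" where
  "eigenvector_points g I V P \<longleftrightarrow> (\<exists>T :: nat \<Rightarrow> complex \<times> complex.
     T ` {1..g} = {(x, y). y \<noteq> 0 \<and> phi g I V 1 x y = 0 \<and> phi g I V 2 x y = 0} \<and>
     (\<forall>x y. y \<noteq> 0 \<longrightarrow> det (lax_block g I V x y) = (\<Prod>i=1..g. x - fst (T i))) \<and>
     (\<forall>i\<in>{1..g}. P i = rho g I V (T i)))"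


section \<open>The functions h_1 and h_2\<close>

definition h1 :: "nat \<Rightarrow> (nat \<Rightarrow> complex) \<Rightarrow> (nat \<Rightarrow> complex) \<Rightarrow> rat_fun" where
  "h1 g I V = (if even g
     then ((\<Sum>i=0..g. monom (s1_c g I V i) i) + monom 1 (g+1), - 1, 1)
     else ((\<Sum>i=0..g. monom (t_c g I V i) i) + monom 1 (g+1), 1, 1))"

text \<open>The part of h_2 not involving v.\<close>

definition h2_poly :: "nat \<Rightarrow> (nat \<Rightarrow> complex) \<Rightarrow> (nat \<Rightarrow> complex) \<Rightarrow> complex poly" where
  "h2_poly g I V =
     (\<Sum>i=0..g-1. monom (s1_c g I V i + 2 * I 1 * acute_c g I V (i+1)) i) +
     monom (c_coeff g I V g) g + monom 1 (g+1)"

definition h2 :: "nat \<Rightarrow> (nat \<Rightarrow> complex) \<Rightarrow> (nat \<Rightarrow> complex) \<Rightarrow> rat_fun" where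
  "h2 g I V = (h2_poly g I V, 1, 1)"

definition kappa2 :: "nat \<Rightarrow> (nat \<Rightarrow> complex) \<Rightarrow> (nat \<Rightarrow> complex) \<Rightarrow> curve_point set" where
  "kappa2 g I V = {Aff u v | u v. poly (h2_poly g I V) u + v = 0}"

end

theory Submission
  imports Defs
    "HOL-Computational_Algebra.Fundamental_Theorem_Algebra"
    "HOL-Combinatorics.Permutations"
begin

text \<open>
  A function with divisor \<open>D_Q + D_Pbar - 2 D*\<close> has no affine poles, hence has the form
  \<open>a(u) + b(u) v\<close>, and its orders at infinity leave \<open>b = 0\<close> for even g and a nonzero constant b
  for odd g. On the other hand \<open>D_Q\<close> consists of zeros of \<open>h_1 = s(u) \<plusminus> v\<close>, so it contains no
  conjugate pairs and no doubled branch points; a polynomial in u vanishing along \<open>D_Q\<close> is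
  therefore divisible by the product of all \<open>u - u(Q_i)\<close>, of degree g.

  For even g this determines a up to a constant, and the zeros of \<open>a(u)\<close> on the curve are the
  \<open>Q_i\<close> and their conjugates. For odd g the factorization
  \<open>t(u)^2 - F(u) = -2 u \<Delta>(u) (h_2 - h_1)\<close> of the norm of \<open>h_1 = t(u) + v\<close>, where
  \<open>\<Delta>(u)\<close> is the product of the \<open>u - u(P_i)\<close>, shows that \<open>h_2\<close> vanishes along \<open>D_Q\<close>. After
  normalization the difference of the given function and \<open>h_2\<close> is a polynomial in u of degree
  less than g vanishing along \<open>D_Q\<close>, hence zero. The factorization is Euler's identity for the
  continuants that compute the minors of the Lax matrix.
\<close>

section \<open>Continuants and periodic tridiagonal determinants\<close>

text \<open>The three-term recurrence for leading principal minors of a tridiagonal matrix with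
  superdiagonal 1. It is stated over any commutative ring because it serves both for complex numbers
  and for polynomials in x.\<close>

fun continuant :: "(nat \<Rightarrow> 'a::comm_ring_1) \<Rightarrow> (nat \<Rightarrow> 'a) \<Rightarrow> nat \<Rightarrow> 'a" where
  "continuant a b 0 = 1"
| "continuant a b (Suc 0) = a 0"
| "continuant a b (Suc (Suc k)) = a (Suc k) * continuant a b (Suc k) - b k * continuant a b k"

definition tridiag :: "(nat \<Rightarrow> 'a::comm_ring_1) \<Rightarrow> (nat \<Rightarrow> 'a) \<Rightarrow> nat \<Rightarrow> 'a mat" where
  "tridiag a b N = mat N N (\<lambda>(i, j). if i = j then a i else if j = Suc i then 1
     else if i = Suc j then b j else 0)"

text \<open>For g at least 2 the corners (0, g) and (g, 0) are not next to the diagonal, so the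
  cases do not overlap and the order of the tests is harmless.\<close>

definition cyclic_tridiag ::
  "(nat \<Rightarrow> 'a::comm_ring_1) \<Rightarrow> (nat \<Rightarrow> 'a) \<Rightarrow> 'a \<Rightarrow> 'a \<Rightarrow> nat \<Rightarrow> 'a mat" where
  "cyclic_tridiag a b \<alpha> \<beta> g = mat (Suc g) (Suc g) (\<lambda>(i, j). if i = j then a i else if j = Suc i then 1
     else if i = Suc j then b j else if i = 0 \<and> j = g then \<alpha> else if i = g \<and> j = 0 then \<beta> else 0)"

text \<open>Fits the minors of the cyclic matrix without its last row: their last column holds just
  the corner entry and the final 1.\<close>

lemma det_last_column:
  fixes A :: "'a::comm_ring_1 mat"
  assumes A: "A \<in> carrier_mat (Suc k) (Suc k)" and "r < k"
    and zero: "\<And>i. i < k \<Longrightarrow> i \<noteq> r \<Longrightarrow> A $$ (i, k) = 0"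
  shows "det A = A $$ (r, k) * (-1)^(r + k) * det (mat_delete A r k)
    + A $$ (k, k) * det (mat_delete A k k)"
proof -
  have "det A = (\<Sum>i<Suc k. A $$ (i, k) * cofactor A i k)"
    by (rule laplace_expansion_column[OF A]) simp
  also have "\<dots> = (\<Sum>i\<in>{r, k}. A $$ (i, k) * cofactor A i k)"
    by (rule sum.mono_neutral_right) (use assms in \<open>auto simp: less_Suc_eq\<close>)
  also have "\<dots> = A $$ (r, k) * cofactor A r k + A $$ (k, k) * cofactor A k k"
    using assms by simp
  finally show ?thesis by (simp add: cofactor_def)
qed

lemma det_tridiag: "det (tridiag a b N) = continuant a b N"
proof (induction a b N rule: continuant.induct)
  case (1 a b) then show ?case by (simp add: tridiag_def det_dim_zero)
next
  case (2 a b) then show ?case by (simp add: tridiag_def det_single)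
next
  case (3 a b k)
  let ?A = "tridiag a b (Suc (Suc k))"
  let ?B = "mat_delete ?A (Suc k) k"
  have A: "?A \<in> carrier_mat (Suc (Suc k)) (Suc (Suc k))" by (simp add: tridiag_def)
  have "det ?A = (\<Sum>j<Suc (Suc k). ?A $$ (Suc k, j) * cofactor ?A (Suc k) j)"
    by (rule laplace_expansion_row[OF A]) simp
  also have "\<dots> = (\<Sum>j\<in>{k, Suc k}. ?A $$ (Suc k, j) * cofactor ?A (Suc k) j)"
    by (rule sum.mono_neutral_right) (auto simp: tridiag_def)
  also have "\<dots> = ?A $$ (Suc k, k) * cofactor ?A (Suc k) k + ?A $$ (Suc k, Suc k) * cofactor ?A (Suc k) (Suc k)"
    by simp
  also have "cofactor ?A (Suc k) (Suc k) = continuant a b (Suc k)"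
  proof -
    have "mat_delete ?A (Suc k) (Suc k) = tridiag a b (Suc k)"
      by (rule eq_matI) (auto simp: mat_delete_def tridiag_def)
    then show ?thesis using 3 by (simp add: cofactor_def)
  qed
  also have "cofactor ?A (Suc k) k = - continuant a b k"
  proof -
    have B: "?B \<in> carrier_mat (Suc k) (Suc k)" by (simp add: tridiag_def mat_delete_def)
    have "det ?B = (\<Sum>i<Suc k. ?B $$ (i, k) * cofactor ?B i k)"
      by (rule laplace_expansion_column[OF B]) simp
    also have "\<dots> = (\<Sum>i\<in>{k}. ?B $$ (i, k) * cofactor ?B i k)"
      by (rule sum.mono_neutral_right) (auto simp: tridiag_def mat_delete_def)
    also have "\<dots> = det (mat_delete ?B k k)"
      by (simp add: cofactor_def) (simp add: tridiag_def mat_delete_def)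
    also have "mat_delete ?B k k = tridiag a b k"
      by (rule eq_matI) (auto simp: mat_delete_def tridiag_def)
    finally show ?thesis using 3 by (simp add: cofactor_def)
  qed
  finally show ?case by (simp add: tridiag_def algebra_simps)
qed

text \<open>The last row has three nonzero entries. The minors belonging to \<open>\<beta>\<close>
  and to \<open>b (g - 1)\<close> still carry \<open>\<alpha>\<close> at the top of their last
  column and are expanded once more; of the two pieces of each, one is tridiagonal and gives a
  continuant, the other is triangular. The triangular pieces make up the final summand.\<close>

lemma det_cyclic_tridiag:
  assumes "g \<ge> 2"
  shows "det (cyclic_tridiag a b \<alpha> \<beta> g) =
    a g * continuant a b g - b (g - 1) * continuant a b (g - 1)
    - \<alpha> * \<beta> * continuant (\<lambda>i. a (Suc i)) (\<lambda>i. b (Suc i)) (g - 1)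
    + (-1)^g * (\<beta> + \<alpha> * (\<Prod>j<g. b j))"
proof -
  obtain k where g: "g = Suc k" and k: "k \<ge> 1" using assms by (cases g) auto
  let ?M = "cyclic_tridiag a b \<alpha> \<beta> g"
  let ?N = "mat_delete ?M g k" and ?O = "mat_delete ?M g 0"
  have M: "?M \<in> carrier_mat (Suc g) (Suc g)" by (simp add: cyclic_tridiag_def)
  have N: "?N \<in> carrier_mat (Suc k) (Suc k)" and O: "?O \<in> carrier_mat (Suc k) (Suc k)"
    using M g by (auto simp: mat_delete_def)
  have "det ?M = (\<Sum>j<Suc g. ?M $$ (g, j) * cofactor ?M g j)"
    by (rule laplace_expansion_row[OF M]) simp
  also have "\<dots> = (\<Sum>j\<in>{0, k, g}. ?M $$ (g, j) * cofactor ?M g j)"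
    by (rule sum.mono_neutral_right) (auto simp: cyclic_tridiag_def g)
  also have "\<dots> = \<beta> * cofactor ?M g 0 + b k * cofactor ?M g k + a g * cofactor ?M g g"
    using k g by (simp add: cyclic_tridiag_def)
  also have "cofactor ?M g g = continuant a b g"
  proof -
    have "mat_delete ?M g g = tridiag a b g"
      by (rule eq_matI) (auto simp: mat_delete_def tridiag_def cyclic_tridiag_def)
    then show ?thesis by (simp add: cofactor_def det_tridiag)
  qed
  also have "cofactor ?M g k = - (continuant a b k + (-1)^k * \<alpha> * (\<Prod>j<k. b j))"
  proof -
    have "det ?N = ?N $$ (0, k) * (-1)^(0 + k) * det (mat_delete ?N 0 k)
        + ?N $$ (k, k) * det (mat_delete ?N k k)"
      by (rule det_last_column[OF N]) (use k in \<open>auto simp: mat_delete_def cyclic_tridiag_def g\<close>)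
    also have "mat_delete ?N k k = tridiag a b k"
      by (rule eq_matI) (auto simp: mat_delete_def tridiag_def cyclic_tridiag_def g)
    also have "det (mat_delete ?N 0 k) = (\<Prod>j<k. b j)"
    proof -
      let ?T = "mat_delete ?N 0 k"
      have T: "?T \<in> carrier_mat k k" using mat_delete_carrier[OF N] by simp
      have "upper_triangular ?T"
        by (rule upper_triangularI) (auto simp: mat_delete_def cyclic_tridiag_def g)
      from det_upper_triangular[OF this T] have "det ?T = prod_list (diag_mat ?T)" .
      also have "diag_mat ?T = map b [0..<k]"
        using T by (auto simp: diag_mat_def) (auto simp: mat_delete_def cyclic_tridiag_def g)
      finally show ?thesis by (simp add: prod.list_conv_set_nth lessThan_atLeast0)
    qed
    also have "?N $$ (0, k) = \<alpha>" using k by (auto simp: mat_delete_def cyclic_tridiag_def g)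
    also have "?N $$ (k, k) = 1" by (auto simp: mat_delete_def cyclic_tridiag_def g)
    finally show ?thesis by (simp add: cofactor_def det_tridiag g algebra_simps)
  qed
  also have "cofactor ?M g 0 = (-1)^g - \<alpha> * continuant (\<lambda>i. a (Suc i)) (\<lambda>i. b (Suc i)) k"
  proof -
    have "det ?O = ?O $$ (0, k) * (-1)^(0 + k) * det (mat_delete ?O 0 k)
        + ?O $$ (k, k) * det (mat_delete ?O k k)"
      by (rule det_last_column[OF O]) (use k in \<open>auto simp: mat_delete_def cyclic_tridiag_def g\<close>)
    also have "mat_delete ?O 0 k = tridiag (\<lambda>i. a (Suc i)) (\<lambda>i. b (Suc i)) k"
      by (rule eq_matI) (auto simp: mat_delete_def tridiag_def cyclic_tridiag_def g)
    also have "det (mat_delete ?O k k) = 1"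
    proof -
      let ?T = "mat_delete ?O k k"
      have T: "?T \<in> carrier_mat k k" using mat_delete_carrier[OF O] by simp
      have "?T $$ (i, j) = 0" if "i < j" "j < k" for i j
        using that by (auto simp: mat_delete_def cyclic_tridiag_def g)
      from det_lower_triangular[OF this T] have "det ?T = prod_list (diag_mat ?T)" .
      also have "diag_mat ?T = map (\<lambda>i. 1) [0..<k]"
        using T by (auto simp: diag_mat_def) (auto simp: mat_delete_def cyclic_tridiag_def g)
      finally show ?thesis by (simp add: prod.list_conv_set_nth)
    qed
    also have "?O $$ (0, k) = \<alpha>" using k by (auto simp: mat_delete_def cyclic_tridiag_def g)
    also have "?O $$ (k, k) = 1" by (auto simp: mat_delete_def cyclic_tridiag_def g)
    finally show ?thesis
      by (simp add: cofactor_def det_tridiag g algebra_simps flip: power_add)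
  qed
  finally show ?thesis by (simp add: g algebra_simps)
qed

lemma continuant_cong:
  assumes "\<And>i. i < k \<Longrightarrow> a i = a' i" "\<And>i. Suc i < k \<Longrightarrow> b i = b' i"
  shows "continuant a b k = continuant a' b' k"
  using assms by (induction a b k rule: continuant.induct) auto

text \<open>A determinant is linear in its first diagonal entry, with the complementary minor as
  coefficient. Setting V_1 = 0 lowers exactly this entry of the Lax block.\<close>

lemma continuant_first_entry:
  "continuant (\<lambda>i. if i = 0 then a 0 - v else a i) b (Suc k) =
    continuant a b (Suc k) - v * continuant (\<lambda>i. a (Suc i)) (\<lambda>i. b (Suc i)) k"
proof (induction a b k rule: continuant.induct)
  case (3 a b k)
  show ?case
    by (simp only: continuant.simps(3)[of _ _ "Suc k"] continuant.simps(3)[of "\<lambda>i. a (Suc i)" _ k] 3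
        nat.distinct if_False) (simp only: algebra_simps)
qed (simp_all add: algebra_simps)

text \<open>Euler's identity. Expanding the second factor of the first product and the first factor
  of the second one cancels the terms with the diagonal entry and leaves the same expression one
  index lower, times the next \<open>b\<close>.\<close>

lemma continuant_Euler:
  "continuant a b (Suc k) * continuant (\<lambda>i. a (Suc i)) (\<lambda>i. b (Suc i)) (Suc k) -
    continuant a b (Suc (Suc k)) * continuant (\<lambda>i. a (Suc i)) (\<lambda>i. b (Suc i)) k = (\<Prod>j<Suc k. b j)"
proof (induction k)
  case 0 then show ?case by (simp add: algebra_simps)
next
  case (Suc k)
  let ?T = "continuant a b" and ?S = "continuant (\<lambda>i. a (Suc i)) (\<lambda>i. b (Suc i))"
  have "?T (Suc (Suc k)) * ?S (Suc (Suc k)) - ?T (Suc (Suc (Suc k))) * ?S (Suc k) =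
      b (Suc k) * (?T (Suc k) * ?S (Suc k) - ?T (Suc (Suc k)) * ?S k)"
    by (simp only: continuant.simps(3)[of a b "Suc k"] continuant.simps(3)[of "\<lambda>i. a (Suc i)" "\<lambda>i. b (Suc i)" k])
      (simp only: algebra_simps)
  then show ?case using Suc by (simp only: prod.lessThan_Suc[of b "Suc k"] mult.commute)
qed

lemma poly_continuant:
  "poly (continuant a b k) x = continuant (\<lambda>i. poly (a i) x) (\<lambda>i. poly (b i) x) k"
  by (induction a b k rule: continuant.induct) simp_all

lemma monic_diff_lower:
  fixes p q :: "'a::comm_ring_1 poly"
  assumes "degree p = n" "lead_coeff p = 1" "q = 0 \<or> degree q < n"
  shows "degree (p - q) = n" "lead_coeff (p - q) = 1"
proof -
  have c: "coeff (p - q) n = 1" using assms by (auto simp: coeff_eq_0)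
  have "degree (p - q) \<le> n" using assms by (auto intro!: degree_diff_le)
  moreover have "n \<le> degree (p - q)" by (rule le_degree) (simp only: c one_neq_zero not_False_eq_True)
  ultimately show d: "degree (p - q) = n" by simp
  show "lead_coeff (p - q) = 1" unfolding d by (rule c)
qed

lemma monic_linear_mult:
  fixes p :: "'a::idom poly"
  assumes "degree p = n" "lead_coeff p = 1"
  shows "degree ([:c, 1:] * p) = Suc n" "lead_coeff ([:c, 1:] * p) = 1"
proof -
  have "p \<noteq> 0" using assms(2) by auto
  then show "degree ([:c, 1:] * p) = Suc n" using assms(1) by (subst degree_mult_eq) auto
  show "lead_coeff ([:c, 1:] * p) = 1" using assms(2) by (simp only: lead_coeff_mult) simp
qed

lemma continuant_monic:
  fixes c e :: "nat \<Rightarrow> 'a::idom"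
  shows "degree (continuant (\<lambda>i. [:c i, 1:]) (\<lambda>i. [:e i:]) k) = k \<and>
    lead_coeff (continuant (\<lambda>i. [:c i, 1:]) (\<lambda>i. [:e i:]) k) = 1"
proof (induction "\<lambda>i. [:c i, 1:]" "\<lambda>i. [:e i:]" k rule: continuant.induct)
  case (3 k)
  let ?T = "continuant (\<lambda>i. [:c i, 1:]) (\<lambda>i. [:e i:])"
  have "degree ([:e k:] * ?T k) < Suc (Suc k)"
    using 3 degree_smult_le[of "e k" "?T k"] by simp
  then show ?case
    using monic_linear_mult[of "?T (Suc k)" "Suc k" "c (Suc k)"] 3
      monic_diff_lower[of "[:c (Suc k), 1:] * ?T (Suc k)" "Suc (Suc k)" "[:e k:] * ?T k"]
    unfolding continuant.simps(3) by blast
qed simp_all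


section \<open>The spectral polynomial\<close>

text \<open>The k x k leading minor of x Id + L as a polynomial in x. Row i, counted from 0, carries
  I_(i+2) + V_(i+1) on the diagonal, whence the shifts.\<close>

definition toda_cont :: "(nat \<Rightarrow> complex) \<Rightarrow> (nat \<Rightarrow> complex) \<Rightarrow> nat \<Rightarrow> complex poly" where
  "toda_cont I V = continuant (\<lambda>i. [:I (i + 2) + V (i + 1), 1:]) (\<lambda>i. [:I (i + 2) * V (i + 2):])"

text \<open>Shifting both index functions removes the first row and column.\<close>

abbreviation toda_cont1 :: "(nat \<Rightarrow> complex) \<Rightarrow> (nat \<Rightarrow> complex) \<Rightarrow> nat \<Rightarrow> complex poly" where
  "toda_cont1 I V \<equiv> toda_cont (\<lambda>i. I (Suc i)) (\<lambda>i. V (Suc i))"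

text \<open>The y-free part of the cyclic determinant; the two corner entries enter it through their
  product I_1 V_1.\<close>

definition toda_poly :: "nat \<Rightarrow> (nat \<Rightarrow> complex) \<Rightarrow> (nat \<Rightarrow> complex) \<Rightarrow> complex poly" where
  "toda_poly g I V = [:I 1 + V (g+1), 1:] * toda_cont I V g
     - (smult (I (g+1) * V (g+1)) (toda_cont I V (g - 1)) + smult (I 1 * V 1) (toda_cont1 I V (g - 1)))"

lemma toda_cont_monic: "degree (toda_cont I V k) = k" "lead_coeff (toda_cont I V k) = 1"
  unfolding toda_cont_def
  using continuant_monic[of "\<lambda>i. I (i + 2) + V (i + 1)" "\<lambda>i. I (i + 2) * V (i + 2)" k]
  by blast+

lemma toda_poly_monic:
  assumes "g \<ge> 1"
  shows "degree (toda_poly g I V) = g + 1" "lead_coeff (toda_poly g I V) = 1"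
proof -
  let ?q = "smult (I (g+1) * V (g+1)) (toda_cont I V (g - 1)) + smult (I 1 * V 1) (toda_cont1 I V (g - 1))"
  have "degree ?q \<le> g - 1"
    by (intro degree_add_le order_trans[OF degree_smult_le]) (simp_all add: toda_cont_monic)
  then have "?q = 0 \<or> degree ?q < Suc g" by (intro disjI2) linarith
  then show "degree (toda_poly g I V) = g + 1" "lead_coeff (toda_poly g I V) = 1"
    using monic_diff_lower[of "[:I 1 + V (g+1), 1:] * toda_cont I V g" "Suc g" ?q]
      monic_linear_mult[OF toda_cont_monic, of "I 1 + V (g+1)" I V g]
    unfolding toda_poly_def by simp_all
qed

lemma wrap_succ: "i < g \<Longrightarrow> wrap g (int i + 2) = i + 2" "wrap g (int g + 2) = 1"
proof -
  assume "i < g"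
  then have "(1 + int i) mod (1 + int g) = 1 + int i" by (intro mod_pos_pos_trivial) auto
  then show "wrap g (int i + 2) = i + 2" by (simp add: wrap_def add.commute)
next
  show "wrap g (int g + 2) = 1" by (simp add: wrap_def add.commute)
qed

lemma lax_mat_cyclic_tridiag:
  assumes "g \<ge> 2"
  shows "x \<cdot>\<^sub>m 1\<^sub>m (g+1) + lax_mat g I V y =
    cyclic_tridiag (\<lambda>i. x + (if i = g then I 1 else I (i + 2)) + V (i + 1)) (\<lambda>j. I (j + 2) * V (j + 2))
      ((-1)^g * I 1 * V 1 / y) ((-1)^g * y) g"
  using assms
  by (intro eq_matI)
    (auto simp: lax_mat_def lax_def cyclic_tridiag_def wrap_succ less_Suc_eq algebra_simps)

lemma poly_toda_cont:
  "poly (toda_cont I V k) x = continuant (\<lambda>i. x + I (i + 2) + V (i + 1)) (\<lambda>i. I (i + 2) * V (i + 2)) k"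
  by (simp add: toda_cont_def poly_continuant algebra_simps)

lemma det_lax_block:
  assumes "g \<ge> 2"
  shows "det (lax_block g I V x y) = poly (toda_cont I V g) x"
proof -
  have "lax_block g I V x y = tridiag (\<lambda>i. x + I (i + 2) + V (i + 1)) (\<lambda>i. I (i + 2) * V (i + 2)) g"
    unfolding lax_block_def lax_mat_cyclic_tridiag[OF assms]
    by (rule eq_matI) (auto simp: cyclic_tridiag_def tridiag_def)
  then show ?thesis by (simp add: det_tridiag poly_toda_cont)
qed

lemma prod_Suc_shift: "(\<Prod>i=1..g+1. f i) = f 1 * (\<Prod>j<g. f (j + 2))"
  for f :: "nat \<Rightarrow> 'a::comm_monoid_mult"
proof -
  have "(\<Prod>i=1..g+1. f i) = (\<Prod>j\<in>{0..g}. f (Suc j))"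
    using prod.atLeast_Suc_atMost_Suc_shift[of f 0 g] by simp
  also have "\<dots> = (\<Prod>j<Suc g. f (Suc j))" by (simp add: atLeast0AtMost lessThan_Suc_atMost)
  also have "\<dots> = f 1 * (\<Prod>j<g. f (j + 2))" by (subst prod.lessThan_Suc_shift) simp
  finally show ?thesis .
qed

text \<open>In the cyclic expansion the product of the corners is free of y, while the corners taken
  singly give y and c/y: their signs (-1)^g cancel against that of the expansion, and I_1 V_1
  completes the product of the subdiagonal entries to c.\<close>

lemma det_lax:
  assumes g: "g \<ge> 2" and y: "y \<noteq> 0"
  shows "y * det (x \<cdot>\<^sub>m 1\<^sub>m (g+1) + lax_mat g I V y) =
    y^2 + y * poly (toda_poly g I V) x + (\<Prod>i=1..g+1. I i) * (\<Prod>i=1..g+1. V i)"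
proof -
  let ?a = "\<lambda>i. x + (if i = g then I 1 else I (i + 2)) + V (i + 1)" and ?b = "\<lambda>j. I (j + 2) * V (j + 2)"
  have 1: "continuant ?a ?b k = poly (toda_cont I V k) x" if "k \<le> g" for k
    unfolding poly_toda_cont by (rule continuant_cong) (use that in auto)
  have 2: "continuant (\<lambda>i. ?a (Suc i)) (\<lambda>i. ?b (Suc i)) (g - 1) = poly (toda_cont1 I V (g - 1)) x"
    unfolding poly_toda_cont by (rule continuant_cong) (use g in auto)
  have "?b (g - 1) = I (g + 1) * V (g + 1)" using g by (simp add: Suc_diff_Suc numeral_2_eq_2)
  then have det: "det (x \<cdot>\<^sub>m 1\<^sub>m (g+1) + lax_mat g I V y) =
      (x + I 1 + V (g + 1)) * poly (toda_cont I V g) x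
      - I (g + 1) * V (g + 1) * poly (toda_cont I V (g - 1)) x
      - ((-1)^g * I 1 * V 1 / y) * ((-1)^g * y) * poly (toda_cont1 I V (g - 1)) x
      + (-1)^g * ((-1)^g * y + (-1)^g * I 1 * V 1 / y * (\<Prod>j<g. ?b j))"
    unfolding lax_mat_cyclic_tridiag[OF g] det_cyclic_tridiag[OF g] 2 using 1 by simp
  have sq: "((-1)^g * (-1)^g :: complex) = 1" by (simp flip: power_mult_distrib)
  have "((-1)^g * I 1 * V 1 / y) * ((-1)^g * y) = ((-1)^g * (-1)^g) * (I 1 * V 1)"
    using y by (simp add: field_simps)
  then have e1: "((-1)^g * I 1 * V 1 / y) * ((-1)^g * y) = I 1 * V 1" unfolding sq by simp
  have "(-1)^g * ((-1)^g * y + (-1)^g * I 1 * V 1 / y * (\<Prod>j<g. ?b j)) =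
      ((-1)^g * (-1)^g) * (y + I 1 * V 1 / y * (\<Prod>j<g. ?b j))"
    by (simp add: algebra_simps)
  then have e2: "(-1)^g * ((-1)^g * y + (-1)^g * I 1 * V 1 / y * (\<Prod>j<g. ?b j)) =
      y + I 1 * V 1 / y * (\<Prod>j<g. ?b j)" unfolding sq by simp
  have pr: "(\<Prod>i=1..g+1. I i) * (\<Prod>i=1..g+1. V i) = I 1 * V 1 * (\<Prod>j<g. ?b j)"
    by (simp only: prod_Suc_shift prod.distrib) (simp only: ac_simps)
  show ?thesis unfolding det e1 e2 pr using y
    by (simp add: toda_poly_def field_simps power2_eq_square)
qed

lemma spectral_data_eq:
  assumes g: "g \<ge> 2"
  shows "spectral_data g I V = (toda_poly g I V, (\<Prod>i=1..g+1. I i) * (\<Prod>i=1..g+1. V i))"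
  unfolding spectral_data_def
proof (rule the_equality)
  show "case (toda_poly g I V, (\<Prod>i=1..g+1. I i) * (\<Prod>i=1..g+1. V i)) of (p, c) \<Rightarrow>
    degree p = g + 1 \<and> lead_coeff p = 1 \<and> (\<forall>x y. y \<noteq> 0 \<longrightarrow>
      y * det (x \<cdot>\<^sub>m 1\<^sub>m (g+1) + lax_mat g I V y) = y^2 + y * poly p x + c)"
    using det_lax[OF g] toda_poly_monic g by simp
next
  fix pc :: "complex poly \<times> complex"
  assume "case pc of (p, c) \<Rightarrow> degree p = g + 1 \<and> lead_coeff p = 1 \<and> (\<forall>x y. y \<noteq> 0 \<longrightarrow>
      y * det (x \<cdot>\<^sub>m 1\<^sub>m (g+1) + lax_mat g I V y) = y^2 + y * poly p x + c)"
  then obtain p c where pc: "pc = (p, c)" and e: "\<And>x y. y \<noteq> 0 \<Longrightarrow>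
      y * det (x \<cdot>\<^sub>m 1\<^sub>m (g+1) + lax_mat g I V y) = y^2 + y * poly p x + c" by (cases pc) auto
  let ?c = "(\<Prod>i=1..g+1. I i) * (\<Prod>i=1..g+1. V i)"
  have e': "y * poly p x + c = y * poly (toda_poly g I V) x + ?c" if "y \<noteq> 0" for x y
    using e[OF that, of x] det_lax[OF g that, of x I V] by simp
  \<comment> \<open>The values at y = 1 and y = -1 separate c from p: their sum is 2 c.\<close>
  have c: "poly p x + c = poly (toda_poly g I V) x + ?c" "- poly p x + c = - poly (toda_poly g I V) x + ?c" for x
    using e'[of 1 x] e'[of "-1" x] by simp_all
  have "2 * c = (poly p 0 + c) + (- poly p 0 + c)" by simp
  also have "\<dots> = 2 * ?c" unfolding c by simp
  finally have cc: "c = ?c" by simp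
  have "poly p = poly (toda_poly g I V)" using c(1) unfolding cc by (intro ext) simp
  then show "pc = (toda_poly g I V, ?c)" unfolding pc cc by (simp add: poly_eq_poly_eq_iff)
qed

text \<open>The continuants begin at I_2 or later, so I_1 enters only through the last diagonal
  entry and the corner product, linearly in both. Flipping its sign subtracts twice the I_1 part;
  the bracket is the continuant with V_1 removed from its first entry.\<close>

lemma toda_poly_s1:
  assumes "g \<ge> 2"
  shows "toda_poly g (I(1 := - I 1)) V =
    toda_poly g I V - smult (2 * I 1) (toda_cont I V g - smult (V 1) (toda_cont1 I V (g - 1)))"
proof -
  have "toda_cont (I(1 := - I 1)) V k = toda_cont I V k" for k
    unfolding toda_cont_def by (rule continuant_cong) auto
  moreover have "toda_cont1 (I(1 := - I 1)) V k = toda_cont1 I V k" for k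
    unfolding toda_cont_def by (rule continuant_cong) auto
  ultimately show ?thesis using assms
    by (intro iffD1[OF poly_eq_poly_eq_iff] ext) (simp add: toda_poly_def algebra_simps)
qed

text \<open>The continuants stop at V_g, so V_(g+1) occurs linearly, in the last diagonal entry and
  in the last subdiagonal product.\<close>

lemma toda_poly_t:
  assumes "g \<ge> 2"
  shows "toda_poly g I (V(g+1 := - V (g+1))) =
    toda_poly g I V - smult (2 * V (g+1)) (toda_cont I V g - smult (I (g+1)) (toda_cont I V (g - 1)))"
proof -
  have "toda_cont I (V(g+1 := - V (g+1))) k = toda_cont I V k" if "k \<le> g" for k
    unfolding toda_cont_def by (rule continuant_cong) (use that in auto)
  moreover have "toda_cont1 I (V(g+1 := - V (g+1))) (g - 1) = toda_cont1 I V (g - 1)"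
    unfolding toda_cont_def by (rule continuant_cong) (use assms in auto)
  ultimately show ?thesis using assms
    by (intro iffD1[OF poly_eq_poly_eq_iff] ext) (simp add: toda_poly_def algebra_simps)
qed

lemma toda_cont_cut:
  "toda_cont (I(1 := 0)) (V(1 := 0)) (Suc k) = toda_cont I V (Suc k) - smult (V 1) (toda_cont1 I V k)"
proof -
  let ?a = "\<lambda>i. [:I (i + 2) + V (i + 1), 1:]" and ?b = "\<lambda>i. [:I (i + 2) * V (i + 2):]"
  have "toda_cont (I(1 := 0)) (V(1 := 0)) (Suc k) =
      continuant (\<lambda>i. if i = 0 then ?a 0 - [:V 1:] else ?a i) ?b (Suc k)"
    unfolding toda_cont_def by (rule continuant_cong) auto
  also have "\<dots> = continuant ?a ?b (Suc k) - [:V 1:] * continuant (\<lambda>i. ?a (Suc i)) (\<lambda>i. ?b (Suc i)) k"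
    by (rule continuant_first_entry)
  finally show ?thesis by (simp add: toda_cont_def)
qed

lemma toda_poly_acute:
  assumes "g \<ge> 2"
  shows "toda_poly g (I(1 := 0)) (V(1 := 0)) =
    [:V (g+1), 1:] * (toda_cont I V g - smult (V 1) (toda_cont1 I V (g - 1)))
    - smult (I (g+1) * V (g+1)) (toda_cont I V (g - 1) - smult (V 1) (toda_cont1 I V (g - 2)))"
proof -
  obtain k where "g = Suc (Suc k)" using assms by (metis le_iff_add add_2_eq_Suc)
  then show ?thesis by (simp add: toda_poly_def toda_cont_cut[unfolded One_nat_def] numeral_2_eq_2)
qed

text \<open>At x = 0 with V_1 = 0 the continuant is a product of entries of \<open>I\<close>:
  inserting the induction hypothesis into the recurrence makes the two terms with V_(k+2)
  cancel.\<close>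

lemma poly_toda_cont_0:
  assumes "V 1 = 0"
  shows "poly (toda_cont I V (Suc k)) 0 = I (k + 2) * poly (toda_cont I V k) 0"
proof (induction k)
  case (Suc k)
  then show ?case unfolding toda_cont_def continuant.simps(3)[of _ _ k] by (simp add: algebra_simps)
qed (simp add: toda_cont_def assms[unfolded One_nat_def])

text \<open>Vanishing at 0 is what permits division by u: the acute coefficients occur in h_2 with
  their index lowered by one.\<close>

lemma poly_toda_poly_acute_0:
  assumes "g \<ge> 2"
  shows "poly (toda_poly g (I(1 := 0)) (V(1 := 0))) 0 = 0"
proof -
  obtain k where "g = Suc k" using assms by (cases g) auto
  then show ?thesis
    using poly_toda_cont_0[of "V(1 := 0)" "I(1 := 0)" k] by (simp add: toda_poly_def)
qed

text \<open>The left-hand side is the norm \<open>h_1 h_1'\<close> of \<open>h_1\<close> for odd g.\<close>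

lemma toda_norm_identity:
  fixes g :: nat and I V :: "nat \<Rightarrow> complex"
  assumes g: "g \<ge> 2"
  defines "p \<equiv> toda_poly g I V" and "s \<equiv> toda_poly g (I(1 := - I 1)) V"
    and "t \<equiv> toda_poly g I (V(g+1 := - V (g+1)))" and "q \<equiv> toda_poly g (I(1 := 0)) (V(1 := 0))"
    and "c \<equiv> (\<Prod>i=1..g+1. I i) * (\<Prod>i=1..g+1. V i)"
  shows "t^2 - (p^2 - [:4 * c:]) =
    smult (- 2) (toda_cont I V g * ([:0, 1:] * (s - t) + smult (2 * I 1) q))"
proof -
  obtain k where k: "g = Suc (Suc k)" using g by (metis le_iff_add add_2_eq_Suc)
  have "c = I 1 * V 1 * (\<Prod>j<g. I (j + 2) * V (j + 2))"
    unfolding c_def by (simp only: prod_Suc_shift prod.distrib) (simp only: ac_simps)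
  then have c: "c = I 1 * V 1 * I (g+1) * V (g+1) * (\<Prod>j<Suc k. I (j + 2) * V (j + 2))"
    unfolding k prod.lessThan_Suc[of _ "Suc k"] by simp
  \<comment> \<open>Euler's identity expresses the inner factors of c by continuants; the factors
    with indices 1 and g + 1 have been split off above.\<close>
  have "(\<Prod>j<Suc k. [:I (j + 2) * V (j + 2):]) =
      toda_cont I V (g - 1) * toda_cont1 I V (g - 1) - toda_cont I V g * toda_cont1 I V (g - 2)"
    using continuant_Euler[of "\<lambda>i. [:I (i + 2) + V (i + 1), 1:]" "\<lambda>i. [:I (i + 2) * V (i + 2):]" k]
    by (simp add: toda_cont_def k numeral_2_eq_2)
  then have prod: "(\<Prod>j<Suc k. I (j + 2) * V (j + 2)) =
      poly (toda_cont I V (g - 1)) x * poly (toda_cont1 I V (g - 1)) x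
      - poly (toda_cont I V g) x * poly (toda_cont1 I V (g - 2)) x" for x
    by (drule_tac f = "\<lambda>p. poly p x" in arg_cong) (simp add: poly_prod ac_simps)
  \<comment> \<open>Pointwise this is now a polynomial identity in x, the entries with indices 1 and
    g + 1, and the values of four continuants.\<close>
  show ?thesis
    unfolding s_def t_def q_def p_def toda_poly_s1[OF g] toda_poly_t[OF g] toda_poly_acute[OF g]
  proof (intro iffD1[OF poly_eq_poly_eq_iff] ext, goal_cases)
    case (1 x)
    show ?case unfolding toda_poly_def c prod[of x]
      by (simp add: power2_eq_square algebra_simps)
  qed
qed


section \<open>Orders of functions on a hyperelliptic curve\<close>

lemma fls_eval_0 [simp]: "fls_eval 0 U = 0"
  by (simp add: fls_eval_def)

lemma fls_eval_pCons [simp]: "fls_eval (pCons c p) U = fls_const c + U * fls_eval p U"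
  by (simp add: fls_eval_def map_poly_pCons)

lemma fls_eval_1 [simp]: "fls_eval 1 U = 1"
  by (simp add: one_pCons)

lemma fls_eval_add [simp]: "fls_eval (p + q) U = fls_eval p U + fls_eval q U"
  by (induction p q rule: poly_induct2) (simp_all add: algebra_simps flip: fls_plus_const)

lemma fls_eval_smult [simp]: "fls_eval (smult c p) U = fls_const c * fls_eval p U"
  by (induction p) (simp_all add: algebra_simps)

lemma fls_eval_minus [simp]: "fls_eval (- p) U = - fls_eval p U"
  using fls_eval_smult[of "-1" p U] by simp

lemma fls_eval_diff [simp]: "fls_eval (p - q) U = fls_eval p U - fls_eval q U"
  using fls_eval_add[of p "- q" U] by simp

lemma fls_eval_mult [simp]: "fls_eval (p * q) U = fls_eval p U * fls_eval q U"
  by (induction p) (simp_all add: algebra_simps)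

lemma fls_eval_power [simp]: "fls_eval (p ^ k) U = fls_eval p U ^ k"
  by (induction k) simp_all

lemma fls_eval_fps:
  obtains E where "fls_eval p (fps_to_fls X) = fps_to_fls E"
    "fps_nth E 0 = poly p (fps_nth X 0)"
    "fps_nth E 1 = poly (pderiv p) (fps_nth X 0) * fps_nth X 1"
proof -
  have "\<exists>E. fls_eval p (fps_to_fls X) = fps_to_fls E \<and> fps_nth E 0 = poly p (fps_nth X 0) \<and>
    fps_nth E 1 = poly (pderiv p) (fps_nth X 0) * fps_nth X 1"
  proof (induction p)
    case 0 then show ?case by (intro exI[of _ 0]) simp
  next
    case (pCons c p)
    then obtain E where E: "fls_eval p (fps_to_fls X) = fps_to_fls E"
      "fps_nth E 0 = poly p (fps_nth X 0)"
      "fps_nth E 1 = poly (pderiv p) (fps_nth X 0) * fps_nth X 1" by blast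
    show ?case
      by (rule exI[of _ "fps_const c + X * E"])
        (use E in \<open>simp add: fls_times_fps_to_fls pderiv_pCons algebra_simps\<close>)
  qed
  then show ?thesis using that by blast
qed

text \<open>The zero series counts as having infinite order, whereas \<open>fls_subdegree\<close>
  assigns it 0.\<close>

definition fls_order_ge :: "int \<Rightarrow> complex fls \<Rightarrow> bool" where
  "fls_order_ge k X \<longleftrightarrow> X = 0 \<or> k \<le> fls_subdegree X"

lemma fls_order_ge_add:
  assumes "fls_order_ge k X" "fls_order_ge k Y" shows "fls_order_ge k (X + Y)"
proof (cases "X + Y = 0")
  case False
  then show ?thesis
    using assms fls_plus_subdegree[OF False] by (auto simp: fls_order_ge_def)
qed (simp add: fls_order_ge_def)

lemma fls_order_ge_mult:
  "fls_order_ge k X \<Longrightarrow> fls_order_ge l Y \<Longrightarrow> fls_order_ge (k + l) (X * Y)"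
  by (cases "X = 0 \<or> Y = 0") (auto simp: fls_order_ge_def)

lemma fls_order_ge_const: "fls_order_ge 0 (fls_const c)"
  by (simp add: fls_order_ge_def)

lemma fls_order_ge_mono: "fls_order_ge k X \<Longrightarrow> l \<le> k \<Longrightarrow> fls_order_ge l X"
  by (auto simp: fls_order_ge_def)

lemma fls_order_ge_fps: "fls_order_ge 0 (fps_to_fls X)"
  by (auto simp: fls_order_ge_def fls_subdegree_fls_to_fps)

lemma fls_subdegree_add_dominant:
  assumes "X \<noteq> 0" "fls_order_ge (fls_subdegree X + 1) Y"
  shows "X + Y \<noteq> 0" "fls_subdegree (X + Y) = fls_subdegree X"
proof -
  have "X + Y \<noteq> 0 \<and> fls_subdegree (X + Y) = fls_subdegree X"
  proof (cases "Y = 0")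
    case False
    then have l: "fls_subdegree X < fls_subdegree Y" using assms by (auto simp: fls_order_ge_def)
    have "X \<noteq> - Y" using l by auto
    then have "X + Y \<noteq> 0" by (simp add: add_eq_0_iff2)
    then show ?thesis using fls_subdegree_add_eq1[OF assms(1) l] by simp
  qed (use assms in auto)
  then show "X + Y \<noteq> 0" "fls_subdegree (X + Y) = fls_subdegree X" by auto
qed

lemma fls_subdegree_fps_unit:
  "fps_nth X 0 \<noteq> 0 \<Longrightarrow> fps_to_fls X \<noteq> 0 \<and> fls_subdegree (fps_to_fls X) = 0"
  by (auto simp: fls_subdegree_fls_to_fps subdegree_eq_0_iff)

lemma fls_subdegree_fps_uniformiser:
  assumes "fps_nth X 0 = 0" "fps_nth X 1 \<noteq> 0"
  shows "fps_to_fls X \<noteq> 0 \<and> fls_subdegree (fps_to_fls X) = 1"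
proof -
  have "subdegree X = 1" using assms by (intro subdegreeI) auto
  then show ?thesis using assms by (auto simp: fls_subdegree_fls_to_fps)
qed

lemma fls_order_ge_1_fps_iff: "fls_order_ge 1 (fps_to_fls X) \<longleftrightarrow> fps_nth X 0 = 0"
  by (cases "X = 0") (auto simp: fls_order_ge_def fls_subdegree_fls_to_fps subdegree_eq_0_iff Suc_le_eq
      intro!: Nat.gr0I)


text \<open>The ramification index of the projection to the u-line: at a branch point v is a
  uniformiser and u minus its value vanishes to order two.\<close>

definition ramification :: "complex \<Rightarrow> nat" where
  "ramification v = (if v = 0 then 2 else 1)"

lemma local_param_affine_eval:
  assumes "local_param F n (Aff u v) U V"
  obtains E where "fls_eval a U + fls_eval b U * V = fps_to_fls E"
    "fps_nth E 0 = poly a u + poly b u * v"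
proof -
  obtain A B where AB: "U = fps_to_fls A" "V = fps_to_fls B" "fps_nth A 0 = u" "fps_nth B 0 = v"
    using assms by auto
  obtain E1 where E1: "fls_eval a (fps_to_fls A) = fps_to_fls E1" "fps_nth E1 0 = poly a (fps_nth A 0)"
    using fls_eval_fps[of a A] by blast
  obtain E2 where E2: "fls_eval b (fps_to_fls A) = fps_to_fls E2" "fps_nth E2 0 = poly b (fps_nth A 0)"
    using fls_eval_fps[of b A] by blast
  show ?thesis
    by (rule that[of "E1 + E2 * B"]) (use AB E1 E2 in \<open>simp_all add: fls_times_fps_to_fls\<close>)
qed

lemma local_param_affine_unit:
  assumes "local_param F n (Aff u v) U V" "poly a u + poly b u * v \<noteq> 0"
  shows "fls_eval a U + fls_eval b U * V \<noteq> 0" "fls_subdegree (fls_eval a U + fls_eval b U * V) = 0"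
  using local_param_affine_eval[OF assms(1), of a b] fls_subdegree_fps_unit assms(2) by metis+

lemma local_param_affine_vanish:
  assumes "local_param F n (Aff u v) U V"
  shows "fls_order_ge 1 (fls_eval a U + fls_eval b U * V) \<longleftrightarrow> poly a u + poly b u * v = 0"
  using local_param_affine_eval[OF assms(1), of a b] fls_order_ge_1_fps_iff by metis

text \<open>The order of a + \<open>\<beta>\<close> v at a point, read off from its norm. Away from
  branch points the conjugate factor is a unit wherever this one vanishes. At a branch point both
  conjugates have order one and u has ramification two, so the order of the norm in u is again the
  right number.\<close>

definition order_at :: "complex poly \<Rightarrow> complex poly \<Rightarrow> complex \<Rightarrow> complex \<Rightarrow> complex \<Rightarrow> nat" where
  "order_at F a \<beta> u v = (if poly a u + \<beta> * v = 0 then order u (a^2 - smult (\<beta>^2) F) else 0)"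

section \<open>Orders at the affine points of a nonsingular curve\<close>

context
  fixes F :: "complex poly"
  assumes nonsingular: "nonsingular_curve F"
begin

lemma branch_simple_root:
  assumes "poly F u = 0"
  obtains G where "F = [:-u, 1:] * G" "poly G u \<noteq> 0"
proof -
  obtain G where G: "F = [:-u, 1:] * G" using assms by (metis dvdE poly_eq_0_iff_dvd)
  have "poly (pderiv F) u \<noteq> 0"
    using nonsingular assms unfolding nonsingular_curve_def by force
  then have "poly G u \<noteq> 0" unfolding G pderiv_mult by (auto simp: pderiv_pCons)
  then show ?thesis using that G by blast
qed

lemma order_branch:
  assumes "poly F u = 0" shows "order u F = 1"
proof -
  obtain G where G: "F = [:-u, 1:] * G" "poly G u \<noteq> 0" using branch_simple_root[OF assms] by blast
  have "order u F = order u [:-u, 1:] + order u G"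
    unfolding G(1) by (rule order_mult, rule no_zero_divisors) (use G(2) in auto)
  also have "order u G = 0" using G(2) by (rule order_0I)
  also have "order u [:-u, 1:] = 1" using order_power_n_n[of u 1] by simp
  finally show ?thesis by simp
qed

text \<open>Compare the coefficients of t^0 and t^1 in V^2 = F(U). If v is nonzero, the linear
  coefficient of U cannot vanish, for then that of V would vanish too. If v = 0, then F'(u) is
  nonzero, so U has no linear term, V is a uniformiser, and V^2 = (U - u) G(U) with G(u) nonzero
  gives order two.\<close>

lemma local_param_affine:
  assumes "local_param F n (Aff u v) U V"
  shows "v^2 = poly F u" "U - fls_const u \<noteq> 0"
    "fls_subdegree (U - fls_const u) = int (ramification v)"
    "v = 0 \<Longrightarrow> V \<noteq> 0 \<and> fls_subdegree V = 1"
proof -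
  obtain A B where UV: "U = fps_to_fls A" "V = fps_to_fls B" "fps_nth A 0 = u" "fps_nth B 0 = v"
    and AB: "fps_nth A 1 \<noteq> 0 \<or> fps_nth B 1 \<noteq> 0" and eq: "V^2 = fls_eval F U"
    using assms by auto
  obtain E where E: "fls_eval F (fps_to_fls A) = fps_to_fls E" "fps_nth E 0 = poly F u"
    "fps_nth E 1 = poly (pderiv F) u * fps_nth A 1" using fls_eval_fps[of F A] UV by metis
  have "fps_to_fls (B * B) = fps_to_fls E"
    using eq E UV by (simp add: power2_eq_square fls_times_fps_to_fls)
  then have BE: "B * B = E" by simp
  have c0: "v * v = poly F u" and c1: "2 * v * fps_nth B 1 = poly (pderiv F) u * fps_nth A 1"
    using E(2,3) UV unfolding BE[symmetric] by (auto simp: algebra_simps)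
  show v2: "v^2 = poly F u" using c0 by (simp add: power2_eq_square)
  have Uu: "U - fls_const u = fps_to_fls (A - fps_const u)" by (simp add: UV)
  have main: "U - fls_const u \<noteq> 0 \<and> fls_subdegree (U - fls_const u) = int (ramification v) \<and>
    (v = 0 \<longrightarrow> V \<noteq> 0 \<and> fls_subdegree V = 1)"
  proof (cases "v = 0")
    case False
    then have "fps_nth A 1 \<noteq> 0" using AB c1 by auto
    then show ?thesis using False UV
      unfolding Uu ramification_def using fls_subdegree_fps_uniformiser[of "A - fps_const u"] by simp
  next
    case True
    have F': "poly (pderiv F) u \<noteq> 0" using nonsingular v2 True
      unfolding nonsingular_curve_def by force
    have A1: "fps_nth A 1 = 0" using c1 True F' by simp
    then have V: "V \<noteq> 0 \<and> fls_subdegree V = 1"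
      using fls_subdegree_fps_uniformiser[of B] AB UV True by simp
    obtain G where G: "F = [:-u, 1:] * G" and Gu: "poly G u \<noteq> 0"
      using branch_simple_root[of u] c0 True by auto
    have GU: "fls_eval G U \<noteq> 0 \<and> fls_subdegree (fls_eval G U) = 0"
      using local_param_affine_unit[OF assms, of G 0] Gu by simp
    have e: "V^2 = (U - fls_const u) * fls_eval G U" using eq unfolding G by (simp add: algebra_simps)
    have nz: "U - fls_const u \<noteq> 0" using e V by auto
    have "fls_subdegree (V^2) = 2" using V by (simp add: fls_subdegree_pow)
    then have "fls_subdegree (U - fls_const u) = 2" unfolding e using nz GU by simp
    then show ?thesis using nz V True by (simp add: ramification_def)
  qed
  show "U - fls_const u \<noteq> 0" "fls_subdegree (U - fls_const u) = int (ramification v)"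
    "v = 0 \<Longrightarrow> V \<noteq> 0 \<and> fls_subdegree V = 1" using main by auto
qed

lemma fls_subdegree_eval_poly:
  assumes "local_param F n (Aff u v) U V" "e \<noteq> 0"
  shows "fls_eval e U \<noteq> 0" "fls_subdegree (fls_eval e U) = int (ramification v * order u e)"
proof -
  obtain q where q: "e = [:-u, 1:] ^ order u e * q" and nq: "\<not> [:-u, 1:] dvd q"
    using order_decomp[OF assms(2)] by blast
  have qu: "poly q u \<noteq> 0" using nq by (simp add: poly_eq_0_iff_dvd)
  have U: "fls_eval [:-u, 1:] U = U - fls_const u" by simp
  have Q: "fls_eval q U \<noteq> 0 \<and> fls_subdegree (fls_eval q U) = 0"
    using local_param_affine_unit[OF assms(1), of q 0] qu by simp
  have e: "fls_eval e U = (U - fls_const u) ^ order u e * fls_eval q U"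
    by (subst q) (simp only: fls_eval_mult fls_eval_power U)
  note lp = local_param_affine[OF assms(1)]
  show "fls_eval e U \<noteq> 0" using e Q lp by simp
  show "fls_subdegree (fls_eval e U) = int (ramification v * order u e)"
    unfolding e using Q lp by (simp add: fls_subdegree_pow)
qed

text \<open>Parity at a root of F, which is simple by nonsingularity: the order of a^2 there is
  even, that of b^2 F odd.\<close>

lemma norm_nonzero:
  assumes "degree F > 0" "b \<noteq> 0"
  shows "a^2 - b^2 * F \<noteq> 0"
proof
  assume e: "a^2 - b^2 * F = 0"
  obtain u where u: "poly F u = 0"
    using alg_closed_imp_poly_has_root[OF assms(1)] by blast
  have F: "F \<noteq> 0" using assms by auto
  have o: "order u F = 1" using order_branch[OF u] .
  have e': "a^2 = b^2 * F" using e by simp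
  have a: "a \<noteq> 0" using e' F assms(2) by auto
  have "order u (a^2) = order u a + order u a" "order u (b^2) = order u b + order u b"
    using a assms(2) by (simp_all add: power2_eq_square order_mult)
  moreover have "order u (b^2 * F) = order u (b^2) + order u F"
    using assms(2) F by (intro order_mult) simp
  ultimately have "2 * order u a = 2 * order u b + 1" using e' o by simp
  then show False by presburger
qed

text \<open>Multiplication by the conjugate a - \<open>\<beta>\<close> v gives the norm, a
  polynomial in u whose order is known. The last claim, that branch points are at most simple zeros,
  later excludes doubled branch points from D_Q.\<close>

lemma fls_subdegree_linear:
  fixes a :: "complex poly"
  assumes lp: "local_param F n (Aff u v) U V" and "\<beta> \<noteq> 0" and F: "degree F > 0"
  defines "X \<equiv> fls_eval a U + fls_const \<beta> * V"
  shows "X \<noteq> 0" "fls_subdegree X = int (order_at F a \<beta> u v)"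
    "v = 0 \<Longrightarrow> order_at F a \<beta> u v \<le> 1"
proof -
  define Y where "Y = fls_eval a U - fls_const \<beta> * V"
  define N where "N = a^2 - smult (\<beta>^2) F"
  have "N = a^2 - [:\<beta>:]^2 * F" by (simp add: N_def power2_eq_square)
  then have N: "N \<noteq> 0" using norm_nonzero[OF F, of "[:\<beta>:]" a] assms(2) by simp
  have eq: "V^2 = fls_eval F U" using lp by auto
  have XY: "X * Y = fls_eval N U"
    by (simp add: X_def Y_def N_def eq[symmetric] fls_const_mult_const[symmetric] power2_eq_square algebra_simps
        del: fls_const_mult_const)
  note NU = fls_subdegree_eval_poly[OF lp N]
  have nz: "X \<noteq> 0" "Y \<noteq> 0" using XY NU by auto
  show "X \<noteq> 0" by fact
  have sum: "fls_subdegree X + fls_subdegree Y = int (ramification v * order u N)"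
    using XY NU nz by (metis fls_subdegree_mult)
  have X': "X = fls_eval a U + fls_eval [:\<beta>:] U * V" by (simp add: X_def)
  have Y': "Y = fls_eval a U + fls_eval [:-\<beta>:] U * V" by (simp add: Y_def)
  have "fls_subdegree X = int (order_at F a \<beta> u v) \<and> (v = 0 \<longrightarrow> order_at F a \<beta> u v \<le> 1)"
  proof (cases "poly a u + \<beta> * v = 0")
    case False
    then show ?thesis using local_param_affine_unit(2)[OF lp, of a "[:\<beta>:]"]
      unfolding X' by (auto simp: order_at_def)
  next
    case True
    show ?thesis
    proof (cases "v = 0")
      case False
      have "poly a u - \<beta> * v \<noteq> 0" using True False assms(2) by (auto simp: algebra_simps)
      then have "fls_subdegree Y = 0" using local_param_affine_unit(2)[OF lp, of a "[:-\<beta>:]"] Y'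
        by simp
      then show ?thesis using sum True False by (simp add: order_at_def ramification_def N_def)
    next
      case v: True
      have au: "poly a u = 0" using True v by simp
      \<comment> \<open>At a branch point the term a(u) has order at least two, so the term with V,
        of order one, dominates in both conjugates.\<close>
      have ge2: "fls_order_ge 2 (fls_eval a U)"
      proof (cases "a = 0")
        case False
        then have "order u a \<ge> 1" using au order_root[of a u] by (simp add: Suc_le_eq)
        then show ?thesis using fls_subdegree_eval_poly[OF lp False] v
          by (auto simp: fls_order_ge_def ramification_def)
      qed (simp add: fls_order_ge_def)
      have bV: "fls_const \<beta> * V \<noteq> 0 \<and> fls_subdegree (fls_const \<beta> * V) = 1"
        using local_param_affine(4)[OF lp v] assms(2) by simp
      have sX: "fls_subdegree X = 1"
        using fls_subdegree_add_dominant(2)[of "fls_const \<beta> * V" "fls_eval a U"] bV ge2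
        by (simp add: X_def add.commute)
      have sY: "fls_subdegree Y = 1"
        using fls_subdegree_add_dominant(2)[of "- (fls_const \<beta> * V)" "fls_eval a U"] bV ge2
        by (simp add: Y_def)
      have "order u N = 1" using sum sX sY v by (simp add: ramification_def)
      then show ?thesis using sX au v by (simp add: order_at_def N_def)
    qed
  qed
  then show "fls_subdegree X = int (order_at F a \<beta> u v)" "v = 0 \<Longrightarrow> order_at F a \<beta> u v \<le> 1" by auto
qed

text \<open>The coordinate ring of a nonsingular affine curve is integrally closed. The roots of d
  are cancelled one at a time: above a root the numerator vanishes at all points of the curve, and
  this forces both a and b to vanish at the root.\<close>

lemma no_affine_poles:
  assumes "d \<noteq> 0"
    and "\<And>u v. v^2 = poly F u \<Longrightarrow>
      \<exists>U V. local_param F n (Aff u v) U V \<and> fls_order_ge 0 (expand (a, b, d) U V)"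
  shows "\<exists>a' b'. a = d * a' \<and> b = d * b'"
  using assms
proof (induction "degree d" arbitrary: a b d)
  case 0
  then obtain c where "d = [:c:]" "c \<noteq> 0" by (metis degree_eq_zeroE pCons_0_0)
  then have "a = d * smult (1/c) a" "b = d * smult (1/c) b" by simp_all
  then show ?case by blast
next
  case (Suc m)
  have "degree d > 0" using Suc.hyps(2) by simp
  then obtain u where u: "poly d u = 0" using alg_closed_imp_poly_has_root by blast
  then obtain d1 where d1: "d = [:-u, 1:] * d1" by (metis dvdE poly_eq_0_iff_dvd)
  have d1nz: "d1 \<noteq> 0" using Suc.prems(1) d1 by auto
  have order_d: "order u d \<ge> 1" using order_root[of d u] u Suc.prems(1) by (simp add: Suc_le_eq)
  have num: "poly a u + poly b u * v = 0" "v = 0 \<Longrightarrow> poly b u = 0" if v: "v^2 = poly F u" for v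
  proof -
    obtain U V where lp: "local_param F n (Aff u v) U V" and ge: "fls_order_ge 0 (expand (a, b, d) U V)"
      using Suc.prems(2)[OF v] by blast
    define X where "X = fls_eval a U + fls_eval b U * V"
    note dU = fls_subdegree_eval_poly[OF lp Suc.prems(1)]
    have X: "X = expand (a, b, d) U V * fls_eval d U" using dU(1) by (simp add: X_def)
    have "fls_order_ge (0 + int (ramification v)) X" unfolding X
    proof (rule fls_order_ge_mult[OF ge])
      show "fls_order_ge (int (ramification v)) (fls_eval d U)"
        unfolding fls_order_ge_def dU(2) of_nat_le_iff using order_d by simp
    qed
    then have geX: "fls_order_ge (int (ramification v)) X" by simp
    then have "fls_order_ge 1 X"
      by (rule fls_order_ge_mono) (simp add: ramification_def)
    then show z: "poly a u + poly b u * v = 0"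
      using local_param_affine_vanish[OF lp] X_def by blast
    \<comment> \<open>A single point lies above u here, so vanishing of the numerator is not enough.
      But d(u) has order at least two at a branch point, and b(u) nonzero would leave the numerator
      with order exactly one.\<close>
    show "poly b u = 0" if v0: "v = 0"
    proof (rule ccontr)
      assume b: "poly b u \<noteq> 0"
      have au: "poly a u = 0" using z v0 by simp
      have ge2: "fls_order_ge 2 (fls_eval a U)"
      proof (cases "a = 0")
        case False
        then have "order u a \<ge> 1" using au order_root[of a u] by (simp add: Suc_le_eq)
        then show ?thesis using fls_subdegree_eval_poly[OF lp False] v0
          by (auto simp: fls_order_ge_def ramification_def)
      qed (simp add: fls_order_ge_def)
      have bU: "fls_eval b U \<noteq> 0" "fls_subdegree (fls_eval b U) = 0"
        using local_param_affine_unit[OF lp, of b 0] b by simp_all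
      have bV: "fls_eval b U * V \<noteq> 0 \<and> fls_subdegree (fls_eval b U * V) = 1"
        using local_param_affine(4)[OF lp v0] bU by simp
      have "X \<noteq> 0 \<and> fls_subdegree X = 1"
        using fls_subdegree_add_dominant[of "fls_eval b U * V" "fls_eval a U"] bV ge2
        by (simp add: X_def add.commute)
      then show False using geX v0 by (simp add: fls_order_ge_def ramification_def)
    qed
  qed
  have ab: "poly a u = 0 \<and> poly b u = 0"
  proof -
    define v where "v = csqrt (poly F u)"
    have v: "v^2 = poly F u" "(-v)^2 = poly F u" by (simp_all add: v_def)
    show ?thesis
    proof (cases "v = 0")
      case True then show ?thesis using num[OF v(1)] by simp
    next
      case False
      have e: "poly a u = poly b u * v" "poly a u + poly b u * v = 0"
        using num(1)[OF v(1)] num(1)[OF v(2)] by simp_all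
      then have "2 * (poly b u * v) = 0" by (simp only: mult_2)
      then have "poly b u = 0" using False by simp
      then show ?thesis using e by simp
    qed
  qed
  then obtain a1 b1 where a1: "a = [:-u, 1:] * a1" and b1: "b = [:-u, 1:] * b1"
    by (metis dvdE poly_eq_0_iff_dvd)
  have "degree d = 1 + degree d1" unfolding d1 using d1nz by (subst degree_mult_eq) auto
  then have m: "m = degree d1" using Suc.hyps(2) by simp
  have "\<exists>a' b'. a1 = d1 * a' \<and> b1 = d1 * b'"
  proof (rule Suc.hyps(1)[OF m d1nz])
    fix x y :: complex assume "y^2 = poly F x"
    then obtain U V where lp: "local_param F n (Aff x y) U V" and ge: "fls_order_ge 0 (expand (a, b, d) U V)"
      using Suc.prems(2) by blast
    have nz: "fls_eval [:-u, 1:] U \<noteq> 0"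
      by (rule fls_subdegree_eval_poly[OF lp]) simp
    have "expand (a, b, d) U V = (fls_eval [:-u, 1:] U * (fls_eval a1 U + fls_eval b1 U * V)) /
        (fls_eval [:-u, 1:] U * fls_eval d1 U)"
      by (simp only: a1 b1 d1 expand.simps fls_eval_mult) (simp only: algebra_simps)
    also have "\<dots> = expand (a1, b1, d1) U V" unfolding expand.simps by (rule mult_divide_mult_cancel_left[OF nz])
    finally have "expand (a, b, d) U V = expand (a1, b1, d1) U V" .
    then show "\<exists>U V. local_param F n (Aff x y) U V \<and> fls_order_ge 0 (expand (a1, b1, d1) U V)"
      using lp ge by metis
  qed
  then show ?case using a1 b1 d1 by (metis mult.assoc)
qed

end

section \<open>Orders at the two points at infinity\<close>

lemma fls_eval_at_infinity:
  assumes "fls_subdegree U = -1" "p \<noteq> 0"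
  shows "fls_eval p U \<noteq> 0" "fls_subdegree (fls_eval p U) = - int (degree p)"
proof -
  have U: "U \<noteq> 0" using assms(1) by auto
  have "fls_eval p U \<noteq> 0 \<and> fls_subdegree (fls_eval p U) = - int (degree p)"
    using assms(2)
  proof (induction p)
    case (pCons c p)
    show ?case
    proof (cases "p = 0")
      case True
      then show ?thesis using pCons by simp
    next
      case False
      then have "U * fls_eval p U \<noteq> 0" "fls_subdegree (U * fls_eval p U) = - 1 - int (degree p)"
        using pCons.IH U assms(1) by simp_all
      then show ?thesis using False
        using fls_subdegree_add_dominant[of "U * fls_eval p U" "fls_const c"]
        by (auto simp: fls_order_ge_def add.commute)
    qed
  qed simp
  then show "fls_eval p U \<noteq> 0" "fls_subdegree (fls_eval p U) = - int (degree p)" by auto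
qed

lemma fls_order_ge_eval_at_infinity:
  "fls_subdegree U = -1 \<Longrightarrow> fls_order_ge (- int (degree p)) (fls_eval p U)"
  using fls_eval_at_infinity[of U p] by (cases "p = 0") (auto simp: fls_order_ge_def)

text \<open>The involution v to -v exchanges the two points, so results at \<open>PInf'\<close>
  follow from those at \<open>PInf\<close>.\<close>

lemma local_param_PInf'_iff: "local_param F n PInf' U V \<longleftrightarrow> local_param F n PInf U (- V)"
proof -
  have "(\<exists>W. V = U^n * fps_to_fls W \<and> fps_nth W 0 = -1) \<longleftrightarrow>
        (\<exists>W. - V = U^n * fps_to_fls W \<and> fps_nth W 0 = 1)"
  proof (safe, goal_cases)
    case (1 W) then show ?case by (intro exI[of _ "- W"]) simp
  next
    case (2 W)
    have "V = - (- V)" by simp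
    also have "\<dots> = U^n * fps_to_fls (- W)" unfolding 2(1) by simp
    finally show ?case using 2(2) by (intro exI[of _ "- W"]) simp
  qed
  then show ?thesis by simp
qed

text \<open>On the curve (v - p)(v + p) = -4 c is a nonzero constant. Both v and p have leading term
  u^n at \<open>PInf\<close>, so v + p has a pole of order n and v - p a zero of order n.\<close>

lemma local_param_PInf_v:
  assumes lp: "local_param F n PInf U V"
    and F: "F = p^2 - [:4 * c:]" and p: "degree p = n" "lead_coeff p = 1" and "c \<noteq> 0" "n > 0"
  shows "V - fls_eval p U \<noteq> 0" "fls_subdegree (V - fls_eval p U) = int n"
proof -
  obtain W where eq: "V^2 = fls_eval F U" and U: "fls_subdegree U = -1"
    and W: "V = U^n * fps_to_fls W" "fps_nth W 0 = 1" using lp by auto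
  have U0: "U \<noteq> 0" using U by auto
  have Un: "2 * U^n \<noteq> 0" "fls_subdegree (2 * U^n) = - int n"
    using U U0 by (simp_all add: fls_subdegree_pow)
  have r: "degree (p - monom 1 n) < n \<or> p - monom 1 n = 0"
  proof -
    have "coeff (p - monom 1 n) n = 0" using p by simp
    moreover have "degree (p - monom 1 n) \<le> n" using p by (intro degree_diff_le) (auto simp: degree_monom_eq)
    ultimately show ?thesis by (metis le_neq_implies_less leading_coeff_0_iff)
  qed
  have mon: "fls_eval (monom 1 n) U = U^n"
    by (simp add: monom_altdef)
  have ge1: "fls_order_ge (- int n + 1) (fls_eval (p - monom 1 n) U)"
    using r fls_order_ge_eval_at_infinity[OF U, of "p - monom 1 n"]
    by (auto intro: fls_order_ge_mono simp: fls_order_ge_def)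
  have ge2: "fls_order_ge (- int n + 1) (U^n * fps_to_fls (W - 1))"
  proof (rule fls_order_ge_mult)
    show "fls_order_ge (- int n) (U^n)" using U by (simp add: fls_order_ge_def fls_subdegree_pow)
    show "fls_order_ge 1 (fps_to_fls (W - 1))" using W by (simp only: fls_order_ge_1_fps_iff) simp
  qed
  have split: "V + fls_eval p U = 2 * U^n + (fls_eval (p - monom 1 n) U + U^n * fps_to_fls (W - 1))"
    using W mon by (simp add: algebra_simps)
  have s: "V + fls_eval p U \<noteq> 0" "fls_subdegree (V + fls_eval p U) = - int n"
    unfolding split using fls_subdegree_add_dominant[OF Un(1), of "fls_eval (p - monom 1 n) U + U^n * fps_to_fls (W - 1)"]
      fls_order_ge_add[OF ge1 ge2] Un(2) by (simp_all del: fls_eval_diff fps_to_fls_minus)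
  have prod: "(V - fls_eval p U) * (V + fls_eval p U) = fls_const (- (4 * c))"
  proof -
    have "(V - fls_eval p U) * (V + fls_eval p U) = V^2 - fls_eval p U ^ 2"
      by (simp add: power2_eq_square algebra_simps)
    also have "\<dots> = fls_const (- (4 * c))" by (simp only: eq F fls_eval_diff fls_eval_power) simp
    finally show ?thesis .
  qed
  have nz: "fls_const (- (4 * c)) \<noteq> 0" using \<open>c \<noteq> 0\<close> by (subst fls_const_eq_0_iff) simp
  show nz': "V - fls_eval p U \<noteq> 0" using prod nz by auto
  have "fls_subdegree (V - fls_eval p U) + fls_subdegree (V + fls_eval p U) = 0"
    using arg_cong[OF prod, of fls_subdegree] fls_subdegree_mult[OF nz' s(1)]
    by (simp only: fls_const_subdegree)
  then show "fls_subdegree (V - fls_eval p U) = int n" using s by simp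
qed

text \<open>Write a + b v = (a + b p) + b (v - p). The second summand has order at least n - deg b,
  and the degree hypothesis makes the first one dominate.\<close>

lemma has_order_PInf:
  assumes ord: "has_order F n (a, b, 1) PInf k"
    and F: "F = p^2 - [:4 * c:]" and p: "degree p = n" "lead_coeff p = 1" and "c \<noteq> 0" "n > 0"
    and nz: "a + b * p \<noteq> 0" and dominant: "degree b < n + degree (a + b * p)"
  shows "k = - int (degree (a + b * p))"
proof -
  obtain U V where lp: "local_param F n PInf U V" and k: "fls_subdegree (expand (a, b, 1) U V) = k"
    using ord by (auto simp: has_order_def)
  have U: "fls_subdegree U = -1" using lp by auto
  note V = local_param_PInf_v[OF lp F p \<open>c \<noteq> 0\<close> \<open>n > 0\<close>]
  have "expand (a, b, 1) U V = fls_eval (a + b * p) U + fls_eval b U * (V - fls_eval p U)"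
    by (simp add: algebra_simps)
  moreover have "fls_order_ge (- int (degree (a + b * p)) + 1) (fls_eval b U * (V - fls_eval p U))"
  proof (rule fls_order_ge_mono[OF fls_order_ge_mult])
    show "fls_order_ge (- int (degree b)) (fls_eval b U)" by (rule fls_order_ge_eval_at_infinity[OF U])
    show "fls_order_ge (int n) (V - fls_eval p U)" using V by (simp add: fls_order_ge_def)
  qed (use dominant in simp)
  ultimately show ?thesis
    using fls_subdegree_add_dominant[OF fls_eval_at_infinity(1)[OF U nz]]
      fls_eval_at_infinity(2)[OF U nz] k by metis
qed

lemma has_order_PInf':
  assumes ord: "has_order F n (a, b, 1) PInf' k"
    and F: "F = p^2 - [:4 * c:]" and p: "degree p = n" "lead_coeff p = 1" and "c \<noteq> 0" "n > 0"
    and nz: "a - b * p \<noteq> 0" and dominant: "degree b < n + degree (a - b * p)"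
  shows "k = - int (degree (a - b * p))"
proof -
  obtain U V where "local_param F n PInf' U V" "fls_subdegree (expand (a, b, 1) U V) = k"
    "expand (a, b, 1) U V \<noteq> 0" using ord by (auto simp: has_order_def)
  then have "has_order F n (a, - b, 1) PInf k"
    unfolding has_order_def local_param_PInf'_iff by (intro exI[of _ U] exI[of _ "- V"]) simp
  from has_order_PInf[OF this F p assms(5,6)] nz dominant show ?thesis by simp
qed

section \<open>Products of linear factors and monic polynomials\<close>

lemma order_linear_factor: "order x [:- a, 1:] = (if x = a then 1 else 0)" for a x :: "'a::idom"
  using order_power_n_n[of a 1] by (auto intro: order_0I)

lemma order_prod_linear:
  fixes f :: "'b \<Rightarrow> 'a::idom"
  assumes "finite S"
  shows "order x (\<Prod>i\<in>S. [:- f i, 1:]) = card {i \<in> S. f i = x}"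
  using assms
proof (induction S rule: finite_induct)
  case (insert j S)
  have nz: "(\<Prod>i\<in>S. [:- f i, 1:]) \<noteq> 0" by (simp add: insert.hyps)
  have nz': "[:- f j, 1:] * (\<Prod>i\<in>S. [:- f i, 1:]) \<noteq> 0" by (rule no_zero_divisors) (use nz in auto)
  have "order x ([:- f j, 1:] * (\<Prod>i\<in>S. [:- f i, 1:])) =
      (if x = f j then 1 else 0) + card {i \<in> S. f i = x}"
    unfolding order_mult[OF nz'] insert.IH order_linear_factor ..
  moreover have "{i \<in> insert j S. f i = x} = (if x = f j then insert j {i \<in> S. f i = x} else {i \<in> S. f i = x})"
    by auto
  ultimately show ?case using insert.hyps by (simp add: prod.insert)
qed simp

lemma prod_linear_dvd:
  fixes f :: "'b \<Rightarrow> 'a::idom"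
  assumes "finite S" "e \<noteq> 0" "\<And>x. card {i \<in> S. f i = x} \<le> order x e"
  shows "(\<Prod>i\<in>S. [:- f i, 1:]) dvd e"
  using assms
proof (induction S arbitrary: e rule: finite_induct)
  case (insert j S)
  have fin: "finite {i \<in> insert j S. f i = x}" for x using insert.hyps by simp
  have "card {i \<in> insert j S. f i = f j} \<noteq> 0" using fin by auto
  then have "order (f j) e \<noteq> 0" using insert.prems(2)[of "f j"] by linarith
  then have "poly e (f j) = 0" using order_root by blast
  then obtain e1 where e1: "e = [:- f j, 1:] * e1" by (metis dvdE poly_eq_0_iff_dvd)
  have e1nz: "e1 \<noteq> 0" using e1 insert.prems(1) by auto
  have "(\<Prod>i\<in>S. [:- f i, 1:]) dvd e1"
  proof (rule insert.IH[OF e1nz])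
    fix x
    have "order x e = (if x = f j then 1 else 0) + order x e1"
      unfolding e1 order_mult[OF insert.prems(1)[unfolded e1]] order_linear_factor ..
    moreover have "{i \<in> insert j S. f i = x} = (if x = f j then insert j {i \<in> S. f i = x} else {i \<in> S. f i = x})"
      by auto
    ultimately show "card {i \<in> S. f i = x} \<le> order x e1"
      using insert.prems(2)[of x] insert.hyps by (simp split: if_splits)
  qed
  then have "[:- f j, 1:] * (\<Prod>i\<in>S. [:- f i, 1:]) dvd e" unfolding e1 by (rule mult_dvd_mono[OF dvd_refl])
  then show ?case unfolding prod.insert[OF insert.hyps] .
qed simp

lemma degree_prod_linear:
  fixes f :: "'b \<Rightarrow> 'a::idom"
  shows "degree (\<Prod>i\<in>S. [:- f i, 1:]) = card S"
  by (subst degree_prod_eq_sum_degree) auto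

lemma monic_sum_of_monoms:
  fixes q :: "'a::comm_ring_1 poly"
  assumes "degree q = g + 1" "lead_coeff q = 1"
  shows "(\<Sum>i=0..g. monom (coeff q i) i) + monom 1 (g+1) = q"
proof -
  have "(\<Sum>i\<le>Suc g. monom (coeff q i) i) = q" using assms by (intro poly_as_sum_of_monoms') simp
  then show ?thesis using assms by (simp add: atLeast0AtMost)
qed

lemma degree_add_monic:
  fixes p q :: "complex poly"
  assumes "degree p = n" "lead_coeff p = 1" "degree q = n" "lead_coeff q = 1"
  shows "degree (p + q) = n"
proof (rule antisym)
  show "degree (p + q) \<le> n" using assms by (intro degree_add_le) auto
  show "n \<le> degree (p + q)" by (rule le_degree) (use assms in simp)
qed


section \<open>Multiplicities of points in divisors\<close>

definition point_count :: "nat \<Rightarrow> (nat \<Rightarrow> curve_point) \<Rightarrow> curve_point \<Rightarrow> nat" where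
  "point_count g Q R = card {i \<in> {1..g}. Q i = R}"

lemma lookup_sum_frag_of:
  "Poly_Mapping.lookup (\<Sum>i=1..g. frag_of (Q i)) R = int (point_count g Q R)"
proof -
  have "Poly_Mapping.lookup (\<Sum>i=1..g. frag_of (Q i)) R = (\<Sum>i=1..g. if R = Q i then 1 else 0)"
    by (simp add: lookup_sum)
  also have "\<dots> = int (card {i \<in> {1..g}. R = Q i})"
    by (subst sum.inter_filter[symmetric]) simp_all
  also have "{i \<in> {1..g}. R = Q i} = {i \<in> {1..g}. Q i = R}" by auto
  finally show ?thesis by (simp only: point_count_def)
qed

lemma point_count_pos: "point_count g Q R > 0 \<longleftrightarrow> R \<in> Q ` {1..g}"
  by (auto simp: point_count_def card_gt_0_iff)

lemma count_image_mset_set: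
  "finite S \<Longrightarrow> count (image_mset f (mset_set S)) R = card {i \<in> S. f i = R}"
proof (induction S rule: finite_induct)
  case (insert j S)
  have "{i \<in> insert j S. f i = R} = (if f j = R then insert j {i \<in> S. f i = R} else {i \<in> S. f i = R})"
    by auto
  then show ?case using insert by simp
qed simp

text \<open>Turns equality of divisors into relabelling: families with equal multiplicities define
  the same multiset.\<close>

lemma permutation_of_point_counts:
  assumes "\<And>R. point_count g P R = point_count g Q R"
  obtains \<sigma> where "bij_betw \<sigma> {1..g} {1..g}" "\<And>i. i \<in> {1..g} \<Longrightarrow> P i = Q (\<sigma> i)"
proof -
  have "image_mset P (mset_set {1..g}) = image_mset Q (mset_set {1..g})"
    by (rule multiset_eqI) (use assms in \<open>simp add: count_image_mset_set point_count_def\<close>)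
  from image_mset_eq_implies_permutes[OF _ this] obtain \<sigma> where
    "\<sigma> permutes {1..g}" "\<forall>i\<in>{1..g}. P i = Q (\<sigma> i)" by auto
  then show ?thesis using that permutes_imp_bij by blast
qed

text \<open>Doubled, as D_star enters the divisors, which also clears the division by two.\<close>

lemma lookup_D_star:
  "Poly_Mapping.lookup (D_star g) (Aff u v) = 0"
  "2 * Poly_Mapping.lookup (D_star g) PInf = (if even g then int g else int g + 1)"
  "2 * Poly_Mapping.lookup (D_star g) PInf' = (if even g then int g else int g - 1)"
  by (auto simp: D_star_def lookup_add elim!: evenE oddE)

lemma order_at_pos: "order_at F a \<beta> u v > 0 \<Longrightarrow> poly a u + \<beta> * v = 0"
  by (auto simp: order_at_def split: if_splits)

section \<open>Zeros of functions and removal of denominators\<close>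

context
  fixes F :: "complex poly" and n :: nat
  assumes nonsingular: "nonsingular_curve F" and degF: "degree F > 0"
    and params: "\<And>u v. v^2 = poly F u \<Longrightarrow> \<exists>U V. local_param F n (Aff u v) U V"
begin

lemma has_order_linear:
  assumes "has_order F n (a, [:\<beta>:], 1) (Aff u v) k" "\<beta> \<noteq> 0"
  shows "k = int (order_at F a \<beta> u v)"
proof -
  obtain U V where "local_param F n (Aff u v) U V" "fls_subdegree (expand (a, [:\<beta>:], 1) U V) = k"
    using assms(1) by (auto simp: has_order_def)
  then show ?thesis using fls_subdegree_linear(2)[OF nonsingular _ assms(2) degF] by fastforce
qed

text \<open>
  A zero divisor of \<open>s + \<beta> v\<close> contains no pair of conjugate points and no doubled branch point,
  so its points are separated by their u-coordinates.
\<close>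

lemma prod_dvd_of_vanishing:
  assumes Q: "\<And>i. i \<in> {1..g} \<Longrightarrow> \<exists>u v. Q i = Aff u v \<and> v^2 = poly F u"
    and "\<beta> \<noteq> 0"
    and s: "\<And>u v. v^2 = poly F u \<Longrightarrow> point_count g Q (Aff u v) \<le> order_at F s \<beta> u v"
    and "e \<noteq> 0"
    and e: "\<And>u v. v^2 = poly F u \<Longrightarrow> point_count g Q (Aff u v) \<le> ramification v * order u e"
  shows "(\<Prod>i=1..g. [:- u_of (Q i), 1:]) dvd e"
proof (rule prod_linear_dvd)
  fix x
  let ?S = "{i \<in> {1..g}. u_of (Q i) = x}"
  show "card ?S \<le> order x e"
  proof (cases "?S = {}")
    case True
    then show ?thesis by (simp only: card.empty)
  next
    case False
    then obtain i where i: "i \<in> {1..g}" "u_of (Q i) = x" by blast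
    then obtain v where Qi: "Q i = Aff x v" and v: "v^2 = poly F x" using Q[OF i(1)] by auto
    have on: "poly s x + \<beta> * w = 0" if "j \<in> {1..g}" "Q j = Aff x w" "w^2 = poly F x" for j w
    proof -
      have "point_count g Q (Aff x w) > 0" unfolding point_count_pos using that by force
      then have "order_at F s \<beta> x w > 0" using s[OF that(3)] by linarith
      then show ?thesis by (rule order_at_pos)
    qed
    \<comment> \<open>All points of Q above x are zeros of s + \<open>\<beta>\<close> v, which
      determines v from x; hence they coincide.\<close>
    have "?S = {j \<in> {1..g}. Q j = Aff x v}"
    proof (intro equalityI subsetI)
      fix j assume j: "j \<in> ?S"
      then obtain w where Qj: "Q j = Aff x w" and w: "w^2 = poly F x" using Q[of j] by auto
      have "poly s x + \<beta> * w = 0" "poly s x + \<beta> * v = 0" using on i j Qi Qj v w by blast+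
      then have "\<beta> * w = \<beta> * v" by (metis add_left_cancel)
      then show "j \<in> {j \<in> {1..g}. Q j = Aff x v}" using Qj j \<open>\<beta> \<noteq> 0\<close> by simp
    qed auto
    then have card: "card ?S = point_count g Q (Aff x v)" by (simp add: point_count_def)
    have pos: "point_count g Q (Aff x v) > 0" unfolding point_count_pos using i Qi by force
    show ?thesis
    proof (cases "v = 0")
      case False
      then show ?thesis using e[OF v] unfolding card ramification_def by simp
    next
      case True
      obtain U V where lp: "local_param F n (Aff x v) U V" using params[OF v] by blast
      \<comment> \<open>At a branch point the hypothesis on e counts with weight two and would bound
        only half the multiplicity; since that multiplicity is at most one, a simple root
        suffices.\<close>
      have "point_count g Q (Aff x v) \<le> 1"
        using s[OF v] fls_subdegree_linear(3)[OF nonsingular lp \<open>\<beta> \<noteq> 0\<close> degF True, of s] by linarith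
      moreover have "order x e \<noteq> 0" using e[OF v] pos by (intro notI) simp
      ultimately show ?thesis unfolding card by linarith
    qed
  qed
qed (use \<open>e \<noteq> 0\<close> in auto)

text \<open>Nonnegative affine coefficients mean no affine poles, so d divides a and b; cancelling
  it leaves all expansions unchanged.\<close>

lemma has_divisor_polynomial:
  assumes div: "has_divisor F n (a, b, d) D" and "d \<noteq> 0"
    and nonneg: "\<And>u v. Poly_Mapping.lookup D (Aff u v) \<ge> 0"
  obtains a' b' where "has_divisor F n (a', b', 1) D"
proof -
  have "\<exists>a' b'. a = d * a' \<and> b = d * b'"
  proof (rule no_affine_poles[OF nonsingular \<open>d \<noteq> 0\<close>, where n = n])
    fix u v assume "v^2 = poly F u"
    then have "has_order F n (a, b, d) (Aff u v) (Poly_Mapping.lookup D (Aff u v))"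
      using div by (auto simp: has_divisor_def curve_def)
    then show "\<exists>U V. local_param F n (Aff u v) U V \<and> fls_order_ge 0 (expand (a, b, d) U V)"
      unfolding has_order_def fls_order_ge_def using nonneg by metis
  qed
  then obtain a' b' where ab: "a = d * a'" "b = d * b'" by blast
  have "has_order F n (a', b', 1) R k" if ord: "has_order F n (a, b, d) R k" for R k
  proof -
    obtain U V where UV: "local_param F n R U V" "expand (a, b, d) U V \<noteq> 0"
      "fls_subdegree (expand (a, b, d) U V) = k" using ord unfolding has_order_def by blast
    have "fls_eval d U \<noteq> 0" using UV(2) by auto
    then have "expand (a, b, d) U V = expand (a', b', 1) U V"
      by (simp add: ab field_simps)
    then show ?thesis using UV unfolding has_order_def by metis
  qed
  then show ?thesis using that[of a' b'] div unfolding has_divisor_def by blast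
qed

end

section \<open>Shape of functions with bounded poles at infinity\<close>

context
  fixes F p :: "complex poly" and c :: complex and n :: nat
  assumes F: "F = p^2 - [:4 * c:]" and p: "degree p = n" "lead_coeff p = 1"
    and c: "c \<noteq> 0" and n: "n > 0"
begin

text \<open>The difference of a + b p and a - b p is 2 b p, of degree deg b + n. If b were nonzero,
  one of the two would have at least this degree and cause a pole of order at least n at
  \<open>PInf\<close> or \<open>PInf'\<close>.\<close>

lemma low_pole_order_imp_no_v:
  assumes "has_order F n (a, b, 1) PInf k" "has_order F n (a, b, 1) PInf' k'"
    and "k > - int n" "k' > - int n"
  shows "b = 0" "a \<noteq> 0" "k = - int (degree a)"
proof -
  show b: "b = 0"
  proof (rule ccontr)
    assume "b \<noteq> 0"
    have "p \<noteq> 0" using p by auto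
    then have d: "degree (smult 2 (b * p)) = degree b + n" using \<open>b \<noteq> 0\<close> p by (simp add: degree_mult_eq)
    have "smult 2 (b * p) = (a + b * p) - (a - b * p)"
      by (intro iffD1[OF poly_eq_poly_eq_iff] ext) simp
    then have "degree b + n \<le> max (degree (a + b * p)) (degree (a - b * p))"
      using degree_diff_le_max d by metis
    then consider "degree b + n \<le> degree (a + b * p)" | "degree b + n \<le> degree (a - b * p)" by linarith
    then show False
    proof cases
      case 1
      then have "a + b * p \<noteq> 0" using n by auto
      then show False using has_order_PInf[OF assms(1) F p c n] 1 assms(3) n by simp
    next
      case 2
      then have "a - b * p \<noteq> 0" using n by auto
      then show False using has_order_PInf'[OF assms(2) F p c n] 2 assms(4) n by simp
    qed
  qed
  show a: "a \<noteq> 0" using assms(1) b by (auto simp: has_order_def)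
  show "k = - int (degree a)" using has_order_PInf[OF assms(1) F p c n] a b n by simp
qed

text \<open>If b = 0, the orders at both points would agree. The weaker pole at \<open>PInf'\<close>
  keeps the degree of a - b p below deg b + n, so a + b p has degree exactly deg b + n; the pole
  order n at \<open>PInf\<close> then makes b constant.\<close>

lemma pole_order_imp_linear_in_v:
  assumes "has_order F n (a, b, 1) PInf (- int n)" "has_order F n (a, b, 1) PInf' k'"
    and "k' > - int n"
  obtains \<beta> where "b = [:\<beta>:]" "\<beta> \<noteq> 0" "a - smult \<beta> p = 0 \<or> int (degree (a - smult \<beta> p)) = - k'"
proof -
  have b: "b \<noteq> 0"
  proof
    assume b: "b = 0"
    then have a: "a \<noteq> 0" using assms(1) by (auto simp: has_order_def)
    have "- int n = - int (degree a)" using has_order_PInf[OF assms(1) F p c n] a b n by simp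
    moreover have "k' = - int (degree a)" using has_order_PInf'[OF assms(2) F p c n] a b n by simp
    ultimately show False using assms(3) by simp
  qed
  have "p \<noteq> 0" using p by auto
  then have d: "degree (smult 2 (b * p)) = degree b + n" using b p by (simp add: degree_mult_eq)
  have less: "degree (a - b * p) < degree b + n"
  proof (rule ccontr)
    assume *: "\<not> ?thesis"
    then have "a - b * p \<noteq> 0" using n by auto
    then show False using has_order_PInf'[OF assms(2) F p c n] * assms(3) n by simp
  qed
  have split: "a + b * p = (a - b * p) + smult 2 (b * p)"
    by (intro iffD1[OF poly_eq_poly_eq_iff] ext) simp
  have deg: "degree (a + b * p) = degree b + n"
    unfolding split using less d degree_add_eq_right[of "a - b * p" "smult 2 (b * p)"] by simp
  then have "a + b * p \<noteq> 0" using n by auto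
  then have "degree b = 0" using has_order_PInf[OF assms(1) F p c n] deg n by simp
  then obtain \<beta> where \<beta>: "b = [:\<beta>:]" by (metis degree_eq_zeroE)
  have "a - smult \<beta> p = 0 \<or> int (degree (a - smult \<beta> p)) = - k'"
    using has_order_PInf'[OF assms(2)[unfolded \<beta>] F p c n] n by fastforce
  then show ?thesis using that[OF \<beta>] b \<beta> by auto
qed

end


section \<open>The functions h_1 and h_2 of the Toda curve\<close>

lemma c_poly_eq: "g \<ge> 2 \<Longrightarrow> c_poly g I V = toda_poly g I V"
  by (simp add: c_poly_def spectral_data_eq)

lemma spectral_F_eq:
  "g \<ge> 2 \<Longrightarrow> spectral_F g I V = (toda_poly g I V)^2 - [:4 * ((\<Prod>i=1..g+1. I i) * (\<Prod>i=1..g+1. V i)):]"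
  by (simp only: spectral_F_def c_minus1_def c_poly_eq spectral_data_eq snd_conv)

lemma h1_eq:
  assumes "g \<ge> 2"
  shows "even g \<Longrightarrow> h1 g I V = (toda_poly g (I(1 := - I 1)) V, [:-1:], 1)"
    and "odd g \<Longrightarrow> h1 g I V = (toda_poly g I (V(g+1 := - V (g+1))), [:1:], 1)"
proof -
  have g: "g \<ge> 1" using assms by simp
  show "even g \<Longrightarrow> h1 g I V = (toda_poly g (I(1 := - I 1)) V, [:-1:], 1)"
    using monic_sum_of_monoms[OF toda_poly_monic[OF g, of "I(1 := - I 1)" V]]
    by (simp add: h1_def s1_c_def c_coeff_def c_poly_eq[OF assms] one_pCons)
  show "odd g \<Longrightarrow> h1 g I V = (toda_poly g I (V(g+1 := - V (g+1))), [:1:], 1)"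
    using monic_sum_of_monoms[OF toda_poly_monic[OF g, of I "V(g+1 := - V (g+1))"]]
    by (simp add: h1_def t_c_def c_coeff_def c_poly_eq[OF assms] one_pCons)
qed

text \<open>The drop to degree exactly g is what lowers the pole of h_1 at \<open>PInf\<close> from
  g + 1 to g for even g.\<close>

lemma toda_poly_diff_s1:
  assumes "g \<ge> 2"
  obtains r where "toda_poly g (I(1 := - I 1)) V = toda_poly g I V - smult (2 * I 1) r"
    "degree r = g" "lead_coeff r = 1"
proof -
  let ?q = "smult (V 1) (toda_cont1 I V (g - 1))"
  have "degree ?q < g" using assms degree_smult_le[of "V 1" "toda_cont1 I V (g - 1)"]
    by (simp add: toda_cont_monic)
  then show ?thesis
    using that[OF toda_poly_s1[OF assms] monic_diff_lower[OF toda_cont_monic disjI2]] by blast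
qed

lemma toda_poly_diff_t:
  assumes "g \<ge> 2"
  obtains r where "toda_poly g I (V(g+1 := - V (g+1))) = toda_poly g I V - smult (2 * V (g+1)) r"
    "degree r = g" "lead_coeff r = 1"
proof -
  let ?q = "smult (I (g+1)) (toda_cont I V (g - 1))"
  have "degree ?q < g" using assms degree_smult_le[of "I (g+1)" "toda_cont I V (g - 1)"]
    by (simp add: toda_cont_monic)
  then show ?thesis
    using that[OF toda_poly_t[OF assms] monic_diff_lower[OF toda_cont_monic disjI2]] by blast
qed

lemma coeff_h2_poly:
  assumes "g \<ge> 2"
  shows "coeff (h2_poly g I V) i =
    (if i < g then s1_c g I V i + 2 * I 1 * acute_c g I V (i+1) else if i = g then c_coeff g I V g
     else if i = g + 1 then 1 else 0)"
proof -
  have "coeff (\<Sum>j=0..g-1. monom (s1_c g I V j + 2 * I 1 * acute_c g I V (j+1)) j) i =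
      (if i < g then s1_c g I V i + 2 * I 1 * acute_c g I V (i+1) else 0)"
    using assms by (auto simp: coeff_sum)
  then show ?thesis by (simp only: h2_poly_def coeff_add coeff_monom) auto
qed

text \<open>Multiplication by u undoes the index shift of the acute coefficients. The constant terms
  agree because the acute polynomial vanishes at 0, and the irregular coefficient c_g of h_2 is
  s_1(c_g) plus 2 I_1 times the leading coefficient 1 of the acute polynomial.\<close>

lemma h2_poly_eq:
  assumes g: "g \<ge> 2"
  shows "[:0, 1:] * h2_poly g I V =
    [:0, 1:] * toda_poly g (I(1 := - I 1)) V + smult (2 * I 1) (toda_poly g (I(1 := 0)) (V(1 := 0)))"
proof -
  define s where "s = toda_poly g (I(1 := - I 1)) V"
  define q where "q = toda_poly g (I(1 := 0)) (V(1 := 0))"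
  have g1: "g \<ge> 1" using g by simp
  have q: "degree q = g + 1" "coeff q (g+1) = 1" and s: "degree s = g + 1" "coeff s (g+1) = 1"
    using toda_poly_monic[OF g1] unfolding q_def s_def by metis+
  have q0: "coeff q 0 = 0" using poly_toda_poly_acute_0[OF g] by (simp add: q_def poly_0_coeff_0)
  obtain r where "s = toda_poly g I V - smult (2 * I 1) r" "degree r = g" "lead_coeff r = 1"
    using toda_poly_diff_s1[OF g] unfolding s_def by blast
  \<comment> \<open>The one coefficient of degree at most g at which the defining formula of h_2
    does not follow the general pattern.\<close>
  then have sg: "coeff s g = coeff (toda_poly g I V) g - 2 * I 1" by auto
  have "coeff (pCons 0 (h2_poly g I V)) k = coeff (pCons 0 s + smult (2 * I 1) q) k" for k
  proof (cases k)
    case (Suc m)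
    have "coeff (h2_poly g I V) m = coeff s m + 2 * I 1 * coeff q (Suc m)"
    proof -
      consider "m < g" | "m = g" | "m = g + 1" | "m > g + 1" by linarith
      then show ?thesis
        unfolding coeff_h2_poly[OF g] c_coeff_def s1_c_def acute_c_def c_poly_eq[OF g]
          q_def[symmetric] s_def[symmetric]
        by cases (use q s sg in \<open>auto simp: coeff_eq_0\<close>)
    qed
    then show ?thesis using Suc by simp
  qed (use q0 in simp)
  then have "pCons 0 (h2_poly g I V) = pCons 0 s + smult (2 * I 1) q" by (rule poly_eqI)
  then show ?thesis by (simp add: s_def q_def)
qed

text \<open>The v-free part of h_2 agrees with p in degrees g and g + 1. For odd g this matches the
  pole order g - 1 required at \<open>PInf'\<close>.\<close>

lemma degree_h2_poly_diff:
  assumes "g \<ge> 2"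
  shows "degree (h2_poly g I V - toda_poly g I V) < g"
proof -
  have "coeff (h2_poly g I V - toda_poly g I V) i = 0" if "i > g - 1" for i
  proof -
    have g: "g \<ge> 1" using assms by simp
    have p: "degree (toda_poly g I V) = g + 1" "coeff (toda_poly g I V) (g + 1) = 1"
      using toda_poly_monic[OF g] by metis+
    have "i = g \<or> i = g + 1 \<or> i > g + 1" using that by linarith
    then show ?thesis using p
      by (auto simp: coeff_h2_poly[OF assms] c_coeff_def c_poly_eq[OF assms] coeff_eq_0)
  qed
  then have "degree (h2_poly g I V - toda_poly g I V) \<le> g - 1" by (intro degree_le) auto
  then show ?thesis using assms by linarith
qed

text \<open>Splits the norm of h_1 for odd g into the parts that account for the P_i, for A, and for
  the remaining zeros Q_i.\<close>

lemma toda_norm_factorization: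
  fixes I V :: "nat \<Rightarrow> complex"
  assumes g: "g \<ge> 2"
  defines "t \<equiv> toda_poly g I (V(g+1 := - V (g+1)))"
  shows "t^2 - spectral_F g I V = smult (- 2) (toda_cont I V g * ([:0, 1:] * (h2_poly g I V - t)))"
proof -
  have "[:0, 1:] * (toda_poly g (I(1 := - I 1)) V - t) + smult (2 * I 1) (toda_poly g (I(1 := 0)) (V(1 := 0)))
      = [:0, 1:] * (h2_poly g I V - t)"
    unfolding right_diff_distrib h2_poly_eq[OF g] by simp
  then show ?thesis
    using toda_norm_identity[OF g, of I V] unfolding t_def spectral_F_eq[OF g] by metis
qed

lemma phase_space_nonzero:
  assumes "(I, V) \<in> phase_space g" "i \<in> {1..g+1}"
  shows "I i \<noteq> 0" "V i \<noteq> 0"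
    "(\<Prod>i=1..g+1. I i) * (\<Prod>i=1..g+1. V i) \<noteq> 0"
proof -
  have "0 < Re (\<Prod>i=1..g+1. V i)" "0 < Re (\<Prod>i=1..g+1. I i)"
    using assms(1) by (auto simp: phase_space_def)
  then have nz: "(\<Prod>i=1..g+1. V i) \<noteq> 0" "(\<Prod>i=1..g+1. I i) \<noteq> 0" by (metis less_irrefl zero_complex.simps(1))+
  then show "I i \<noteq> 0" "V i \<noteq> 0" using assms(2) by (metis finite_atLeastAtMost prod_zero_iff)+
  show "(\<Prod>i=1..g+1. I i) * (\<Prod>i=1..g+1. V i) \<noteq> 0" by (rule no_zero_divisors) (rule nz)+
qed

text \<open>\<open>rho\<close> keeps the x-coordinate, so the monic polynomial with roots
  \<open>u_of (P i)\<close> is the determinant of the upper-left block, and it takes only affine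
  values.\<close>

lemma eigenvector_points_cont:
  assumes g: "g \<ge> 2" and "eigenvector_points g I V P"
  shows "toda_cont I V g = (\<Prod>i=1..g. [:- u_of (P i), 1:])" and "\<And>i. i \<in> {1..g} \<Longrightarrow> \<exists>u v. P i = Aff u v"
proof -
  obtain T where T: "\<And>x y. y \<noteq> 0 \<Longrightarrow> det (lax_block g I V x y) = (\<Prod>i=1..g. x - fst (T i))"
    and P: "\<And>i. i \<in> {1..g} \<Longrightarrow> P i = rho g I V (T i)"
    using assms(2) unfolding eigenvector_points_def by auto
  have u: "u_of (P i) = fst (T i)" if "i \<in> {1..g}" for i using P[OF that] by (simp add: rho_def split_beta)
  show "toda_cont I V g = (\<Prod>i=1..g. [:- u_of (P i), 1:])"
  proof (intro iffD1[OF poly_eq_poly_eq_iff] ext)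
    fix x
    have "poly (toda_cont I V g) x = (\<Prod>i=1..g. x - fst (T i))"
      using T[of 1 x] det_lax_block[OF g, of I V x 1] by simp
    also have "\<dots> = poly (\<Prod>i=1..g. [:- u_of (P i), 1:]) x"
      unfolding poly_prod by (rule prod.cong) (simp_all add: u)
    finally show "poly (toda_cont I V g) x = poly (\<Prod>i=1..g. [:- u_of (P i), 1:]) x" .
  qed
  show "\<exists>u v. P i = Aff u v" if "i \<in> {1..g}" for i
    using P[OF that] by (simp add: rho_def split_beta)
qed

section \<open>The divisors of the theorem and its two cases\<close>

context
  fixes g :: nat and I V :: "nat \<Rightarrow> complex" and P Q Pbar :: "nat \<Rightarrow> curve_point"
    and F :: "complex poly" and A :: curve_point and vA :: complex
  assumes g: "g \<ge> 2" and phase: "(I, V) \<in> phase_space g" and F_eq: "F = spectral_F g I V"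
    and A_eq: "A = Aff 0 vA" and nonsingular: "nonsingular_curve F"
    and eP: "eigenvector_points g I V P"
    and Q_curve: "Q ` {1..g} \<subseteq> curve F"
    and div1: "has_divisor F (g+1) (h1 g I V)
      ((\<Sum>i=1..g. frag_of (Q i)) + (\<Sum>i=1..g. frag_of (P i)) + frag_of A - frag_of PInf' - frag_cmul 2 (D_star g))"
    and Pbar_affine: "\<And>i. i \<in> {1..g} \<Longrightarrow> \<exists>u v. Pbar i = Aff u v"
    and div2: "principal_divisor F (g+1)
      ((\<Sum>i=1..g. frag_of (Q i)) + (\<Sum>i=1..g. frag_of (Pbar i)) - frag_cmul 2 (D_star g))"
begin

abbreviation (input) curve_p where "curve_p \<equiv> toda_poly g I V"
abbreviation (input) curve_s1 where "curve_s1 \<equiv> toda_poly g (I(1 := - I 1)) V"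
abbreviation (input) curve_t where "curve_t \<equiv> toda_poly g I (V(g+1 := - V (g+1)))"

abbreviation (input) div_h1 where "div_h1 \<equiv> (\<Sum>i=1..g. frag_of (Q i)) + (\<Sum>i=1..g. frag_of (P i)) + frag_of A - frag_of PInf' - frag_cmul 2 (D_star g)"
abbreviation (input) div_Q_Pbar where "div_Q_Pbar \<equiv> (\<Sum>i=1..g. frag_of (Q i)) + (\<Sum>i=1..g. frag_of (Pbar i)) - frag_cmul 2 (D_star g)"

lemma monic: "degree (toda_poly g I' V') = g + 1" "lead_coeff (toda_poly g I' V') = 1"
  using g toda_poly_monic by simp_all

lemma nonzero_entries: "I 1 \<noteq> 0" "V (g+1) \<noteq> 0"
  using phase_space_nonzero[OF phase] by simp_all

lemma nonzero_c: "(\<Prod>i=1..g+1. I i) * (\<Prod>i=1..g+1. V i) \<noteq> 0"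
  by (rule phase_space_nonzero(3)[OF phase, of 1]) simp

lemma F_split: "F = curve_p^2 - [:4 * ((\<Prod>i=1..g+1. I i) * (\<Prod>i=1..g+1. V i)):]"
  unfolding F_eq by (rule spectral_F_eq[OF g])

lemma degF: "degree F > 0"
proof -
  have "curve_p \<noteq> 0" using monic(2)[of I V] by auto
  then have d: "degree (curve_p^2) = 2 * (g + 1)" by (simp add: degree_power_eq monic)
  have "coeff F (2 * (g + 1)) = lead_coeff (curve_p^2)" unfolding F_split d coeff_diff by simp
  also have "\<dots> \<noteq> 0" using \<open>curve_p \<noteq> 0\<close> by simp
  finally have "2 * (g + 1) \<le> degree F" by (rule le_degree)
  then show ?thesis by simp
qed

lemma keys_D1: "Poly_Mapping.lookup div_h1 R \<noteq> 0 \<Longrightarrow> R \<in> curve F"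
  using div1 unfolding has_divisor_def in_keys_iff[symmetric] by blast

lemma keys_D2: "Poly_Mapping.lookup div_Q_Pbar R \<noteq> 0 \<Longrightarrow> R \<in> curve F"
  using div2 unfolding principal_divisor_def has_divisor_def in_keys_iff[symmetric] by blast

text \<open>The divisor statement for h_1 already carries a parametrisation at every point of the
  curve, as the witness of the order there.\<close>

lemma params:
  assumes "v^2 = poly F u" shows "\<exists>U W. local_param F (g+1) (Aff u v) U W"
proof -
  have "Aff u v \<in> curve F" using assms by (simp add: curve_def)
  then show ?thesis using div1 unfolding has_divisor_def has_order_def by blast
qed

lemmas lookup_simps = lookup_add lookup_minus lookup_sum_frag_of lookup_frag_cmul lookup_frag_of

lemma lookup_D1:
  "Poly_Mapping.lookup div_h1 (Aff u v) =
    int (point_count g Q (Aff u v)) + int (point_count g P (Aff u v)) + (if Aff u v = A then 1 else 0)"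
  "Poly_Mapping.lookup div_h1 PInf = int (point_count g Q PInf) + int (point_count g P PInf)
    - (if even g then int g else int g + 1)"
  "Poly_Mapping.lookup div_h1 PInf' = int (point_count g Q PInf') + int (point_count g P PInf') - 1
    - (if even g then int g else int g - 1)"
  by (simp_all only: lookup_simps lookup_D_star A_eq curve_point.distinct if_False) simp_all

lemma lookup_D2:
  "Poly_Mapping.lookup div_Q_Pbar (Aff u v) = int (point_count g Q (Aff u v)) + int (point_count g Pbar (Aff u v))"
  "Poly_Mapping.lookup div_Q_Pbar PInf = int (point_count g Q PInf) + int (point_count g Pbar PInf)
    - (if even g then int g else int g + 1)"
  "Poly_Mapping.lookup div_Q_Pbar PInf' = int (point_count g Q PInf') + int (point_count g Pbar PInf')
    - (if even g then int g else int g - 1)"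
  by (simp_all only: lookup_simps lookup_D_star)

lemma order_div1: "R \<in> curve F \<Longrightarrow> has_order F (g+1) (h1 g I V) R (Poly_Mapping.lookup div_h1 R)"
  using div1 unfolding has_divisor_def by blast

text \<open>At one infinite point the leading terms of h_1 cancel and the pole has order exactly g,
  at the other it has order g + 1. These are precisely the poles listed in the divisor, which leaves
  no Q_i at infinity.\<close>

lemma Q_not_infinite: "point_count g Q PInf = 0" "point_count g Q PInf' = 0"
proof -
  have inf: "PInf \<in> curve F" "PInf' \<in> curve F" by (simp_all add: curve_def)
  have n: "g + 1 > 0" by simp
  note ordP = has_order_PInf[OF _ F_split monic nonzero_c n]
    and ordP' = has_order_PInf'[OF _ F_split monic nonzero_c n]
  have "point_count g Q PInf = 0 \<and> point_count g Q PInf' = 0"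
  proof (cases "even g")
    case True
    note h = order_div1[unfolded h1_eq(1)[OF g True]]
    obtain r where r: "curve_s1 = curve_p - smult (2 * I 1) r" "degree r = g" "lead_coeff r = 1"
      using toda_poly_diff_s1[OF g] by blast
    have e1: "curve_s1 + [:-1:] * curve_p = smult (- 2 * I 1) r" unfolding r by simp
    have e2: "curve_s1 - [:-1:] * curve_p = curve_s1 + curve_p" by simp
    have d1: "degree (curve_s1 + [:-1:] * curve_p) = g" unfolding e1 using r nonzero_entries by simp
    have d2: "degree (curve_s1 - [:-1:] * curve_p) = g + 1" unfolding e2 by (rule degree_add_monic[OF monic monic])
    have "Poly_Mapping.lookup div_h1 PInf = - int g"
      using ordP[OF h[OF inf(1)]] d1 g by fastforce
    moreover have "Poly_Mapping.lookup div_h1 PInf' = - int (g + 1)"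
      using ordP'[OF h[OF inf(2)]] d2 g by fastforce
    ultimately show ?thesis unfolding lookup_D1 using True by simp
  next
    case False
    note h = order_div1[unfolded h1_eq(2)[OF g False]]
    obtain r where r: "curve_t = curve_p - smult (2 * V (g+1)) r" "degree r = g" "lead_coeff r = 1"
      using toda_poly_diff_t[OF g] by blast
    have e1: "curve_t - [:1:] * curve_p = smult (- 2 * V (g+1)) r" unfolding r by simp
    have e2: "curve_t + [:1:] * curve_p = curve_t + curve_p" by simp
    have d1: "degree (curve_t - [:1:] * curve_p) = g" unfolding e1 using r nonzero_entries by simp
    have d2: "degree (curve_t + [:1:] * curve_p) = g + 1" unfolding e2 by (rule degree_add_monic[OF monic monic])
    have "Poly_Mapping.lookup div_h1 PInf = - int (g + 1)"
      using ordP[OF h[OF inf(1)]] d2 g by fastforce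
    moreover have "Poly_Mapping.lookup div_h1 PInf' = - int g"
      using ordP'[OF h[OF inf(2)]] d1 g by fastforce
    ultimately show ?thesis unfolding lookup_D1 using False by simp
  qed
  then show "point_count g Q PInf = 0" "point_count g Q PInf' = 0" by auto
qed

lemma Q_affine:
  assumes "i \<in> {1..g}" shows "\<exists>u v. Q i = Aff u v \<and> v^2 = poly F u"
proof -
  have "point_count g Q (Q i) > 0" unfolding point_count_pos using assms by blast
  then have "Q i \<noteq> PInf" "Q i \<noteq> PInf'" using Q_not_infinite by force+
  moreover have "Q i \<in> curve F" using Q_curve assms by blast
  ultimately show ?thesis by (auto simp: curve_def)
qed

lemma Pbar_not_infinite: "point_count g Pbar PInf = 0" "point_count g Pbar PInf' = 0"
proof -
  have "PInf \<notin> Pbar ` {1..g}" "PInf' \<notin> Pbar ` {1..g}" using Pbar_affine by fastforce+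
  then show "point_count g Pbar PInf = 0" "point_count g Pbar PInf' = 0"
    unfolding point_count_pos[symmetric] by simp_all
qed

text \<open>An affine point of P has a positive coefficient in the divisor of h_1, whose support
  lies on the curve.\<close>

lemma P_affine:
  assumes "i \<in> {1..g}" shows "\<exists>u v. P i = Aff u v \<and> v^2 = poly F u"
proof -
  obtain u v where P: "P i = Aff u v" using eigenvector_points_cont(2)[OF g eP assms] by blast
  have "point_count g P (Aff u v) > 0" unfolding point_count_pos using assms P by force
  then have "Poly_Mapping.lookup div_h1 (Aff u v) \<noteq> 0" unfolding lookup_D1 by simp
  then have "Aff u v \<in> curve F" by (rule keys_D1)
  then show ?thesis using P by (auto simp: curve_def)
qed

lemma Pbar_curve: "Pbar ` {1..g} \<subseteq> curve F"
proof
  fix R assume R: "R \<in> Pbar ` {1..g}"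
  then obtain u v where Ruv: "R = Aff u v" using Pbar_affine by blast
  have "point_count g Pbar R > 0" unfolding point_count_pos by (rule R)
  then have "Poly_Mapping.lookup div_Q_Pbar R \<noteq> 0" unfolding Ruv lookup_D2 by simp
  then show "R \<in> curve F" by (rule keys_D2)
qed

lemma principal_function:
  obtains a b where "has_divisor F (g+1) (a, b, 1) div_Q_Pbar"
proof -
  obtain a b d where d: "d \<noteq> 0" and div: "has_divisor F (g+1) (a, b, d) div_Q_Pbar"
    using div2 unfolding principal_divisor_def by blast
  show ?thesis
    by (rule has_divisor_polynomial[OF nonsingular degF params div d])
      (use lookup_D2 that in auto)
qed

lemma h1_order:
  assumes "v^2 = poly F u"
  shows "even g \<Longrightarrow> order_at F curve_s1 (-1) u v = point_count g Q (Aff u v) + point_count g P (Aff u v) + (if Aff u v = A then 1 else 0)"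
    and "odd g \<Longrightarrow> order_at F curve_t 1 u v = point_count g Q (Aff u v) + point_count g P (Aff u v) + (if Aff u v = A then 1 else 0)"
proof -
  have R: "Aff u v \<in> curve F" using assms by (simp add: curve_def)
  have e: "int (point_count g Q (Aff u v) + point_count g P (Aff u v) + (if Aff u v = A then 1 else 0))
      = Poly_Mapping.lookup div_h1 (Aff u v)" unfolding lookup_D1 by simp
  show "order_at F curve_s1 (-1) u v = point_count g Q (Aff u v) + point_count g P (Aff u v) + (if Aff u v = A then 1 else 0)"
    if "even g"
    using has_order_linear[OF nonsingular degF params order_div1[OF R, unfolded h1_eq(1)[OF g that]]]
    unfolding e[symmetric] by (simp only: of_nat_eq_iff) simp
  show "order_at F curve_t 1 u v = point_count g Q (Aff u v) + point_count g P (Aff u v) + (if Aff u v = A then 1 else 0)"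
    if "odd g"
    using has_order_linear[OF nonsingular degF params order_div1[OF R, unfolded h1_eq(2)[OF g that]]]
    unfolding e[symmetric] by (simp only: of_nat_eq_iff) simp
qed

lemma even_case:
  assumes even: "even g"
  shows "\<exists>\<sigma>. bij_betw \<sigma> {1..g} {1..g} \<and> (\<forall>i\<in>{1..g}. Pbar i = hyp_inv (Q (\<sigma> i)))"
proof -
  obtain a b where div: "has_divisor F (g+1) (a, b, 1) div_Q_Pbar" by (rule principal_function)
  have n: "g + 1 > 0" by simp
  have inf: "Poly_Mapping.lookup div_Q_Pbar PInf = - int g" "Poly_Mapping.lookup div_Q_Pbar PInf' = - int g"
    unfolding lookup_D2 Q_not_infinite Pbar_not_infinite using even by simp_all
  have "has_order F (g+1) (a, b, 1) PInf (- int g)" "has_order F (g+1) (a, b, 1) PInf' (- int g)"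
    using div inf unfolding has_divisor_def by (auto simp: curve_def)
  \<comment> \<open>Both poles have order g, one less than that of v.\<close>
  from low_pole_order_imp_no_v[OF F_split monic nonzero_c n this]
  have b: "b = 0" and a: "a \<noteq> 0" and dega: "degree a = g" by simp_all
  have ord: "point_count g Q (Aff u v) + point_count g Pbar (Aff u v) = ramification v * order u a"
    if v: "v^2 = poly F u" for u v
  proof -
    have "has_order F (g+1) (a, b, 1) (Aff u v) (Poly_Mapping.lookup div_Q_Pbar (Aff u v))"
      using div v unfolding has_divisor_def by (auto simp: curve_def)
    then obtain U W where "local_param F (g+1) (Aff u v) U W"
      "fls_subdegree (fls_eval a U) = Poly_Mapping.lookup div_Q_Pbar (Aff u v)"
      unfolding has_order_def using b by auto
    then have "int (point_count g Q (Aff u v) + point_count g Pbar (Aff u v)) = int (ramification v * order u a)"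
      using fls_subdegree_eval_poly(2)[OF nonsingular _ a] unfolding lookup_D2 by (metis of_nat_add)
    then show ?thesis by (simp only: of_nat_eq_iff)
  qed
  let ?q = "\<Prod>i=1..g. [:- u_of (Q i), 1:]"
  have "?q dvd a"
  proof (rule prod_dvd_of_vanishing[OF nonsingular degF params Q_affine])
    show "point_count g Q (Aff u v) \<le> order_at F curve_s1 (- 1) u v" if "v^2 = poly F u" for u v
      unfolding h1_order(1)[OF that even] by simp
    show "point_count g Q (Aff u v) \<le> ramification v * order u a" if "v^2 = poly F u" for u v
      using ord[OF that] by linarith
  qed (use a in auto)
  then obtain r where r: "a = ?q * r" by blast
  have nz: "?q \<noteq> 0" "r \<noteq> 0" using a r by auto
  \<comment> \<open>The divisor and the dividend both have degree g, so the roots of a are the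
    u-coordinates of the Q_i with multiplicity.\<close>
  have "degree r = 0" using dega unfolding r degree_mult_eq[OF nz] degree_prod_linear by simp
  then have "order u r = 0" for u using nz(2) order_degree[of r u] by simp
  moreover have "order u a = order u ?q + order u r" for u
    using a unfolding r by (rule order_mult)
  ultimately have order_a: "order u a = card {i \<in> {1..g}. u_of (Q i) = u}" for u
    by (simp only: order_prod_linear finite_atLeastAtMost add_0_right)
  \<comment> \<open>The points above u are (u, v) and (u, -v), which coincide when v = 0.\<close>
  have count_Q: "card {i \<in> {1..g}. u_of (Q i) = u} =
      (if v = 0 then point_count g Q (Aff u v) else point_count g Q (Aff u v) + point_count g Q (Aff u (- v)))"
    if v: "v^2 = poly F u" for u v
  proof -
    have "{i \<in> {1..g}. u_of (Q i) = u} = {i \<in> {1..g}. Q i = Aff u v} \<union> {i \<in> {1..g}. Q i = Aff u (- v)}"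
    proof (intro equalityI subsetI)
      fix i assume i: "i \<in> {i \<in> {1..g}. u_of (Q i) = u}"
      then obtain w where w: "Q i = Aff u w" "w^2 = poly F u" using Q_affine[of i] by auto
      then have "w = v \<or> w = - v" using v by (metis power2_eq_iff)
      then show "i \<in> {i \<in> {1..g}. Q i = Aff u v} \<union> {i \<in> {1..g}. Q i = Aff u (- v)}" using w i by auto
    qed auto
    moreover have "{i \<in> {1..g}. Q i = Aff u v} \<inter> {i \<in> {1..g}. Q i = Aff u (- v)} = {}" if "v \<noteq> 0"
      using that by auto
    ultimately show ?thesis unfolding point_count_def by (auto simp: card_Un_disjoint)
  qed
  have "point_count g Pbar R = point_count g (\<lambda>i. hyp_inv (Q i)) R" for R
  proof (cases "R \<in> curve F \<and> R \<noteq> PInf \<and> R \<noteq> PInf'")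
    case True
    then obtain u v where R: "R = Aff u v" and v: "v^2 = poly F u" by (auto simp: curve_def)
    have "hyp_inv (Q i) = Aff u v \<longleftrightarrow> Q i = Aff u (- v)" for i
      by (cases "Q i") auto
    then have "point_count g (\<lambda>i. hyp_inv (Q i)) R = point_count g Q (Aff u (- v))"
      by (simp add: R point_count_def)
    \<comment> \<open>Off the branch points the multiplicity of (u, v) in D_Q cancels and that of
      (u, -v) remains. At a branch point the total is twice the multiplicity in D_Q.\<close>
    moreover have "point_count g Pbar R = point_count g Q (Aff u (- v))"
      using ord[OF v] count_Q[OF v] unfolding order_a R ramification_def by (auto split: if_splits)
    ultimately show ?thesis by simp
  next
    case False
    have "R \<notin> Pbar ` {1..g}" using False Pbar_curve Pbar_affine by fastforce
    moreover have "R \<notin> (\<lambda>i. hyp_inv (Q i)) ` {1..g}"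
    proof
      assume "R \<in> (\<lambda>i. hyp_inv (Q i)) ` {1..g}"
      then obtain i where "i \<in> {1..g}" "R = hyp_inv (Q i)" by blast
      then show False using False Q_affine[of i] by (auto simp: curve_def)
    qed
    ultimately show ?thesis unfolding point_count_pos[symmetric] by simp
  qed
  then show ?thesis by (rule permutation_of_point_counts) blast
qed

text \<open>With w = h_2 - h_1, the norm of h_1 is -2 u w times the product of the u - u(P_i). At a
  point of D_Q the order of the norm is the combined multiplicity of Q, P and A; removing the parts
  of P and A leaves the multiplicity of Q as the order of w. Hence h_2 = h_1 + w vanishes to that
  order.\<close>

lemma h2_order_ge:
  assumes odd: "odd g" and v: "v^2 = poly F u" and lp: "local_param F (g+1) (Aff u v) U W"
  shows "fls_order_ge (int (point_count g Q (Aff u v))) (fls_eval (h2_poly g I V) U + W)"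
proof (cases "point_count g Q (Aff u v) = 0")
  case True
  have "fls_order_ge 0 (fls_eval (h2_poly g I V) U + fls_eval 1 U * W)"
    using local_param_affine_eval[OF lp, of "h2_poly g I V" 1] fls_order_ge_fps by metis
  then show ?thesis using True by simp
next
  case False
  let ?k = "point_count g Q (Aff u v)"
  define w where "w = h2_poly g I V - curve_t"
  have N: "curve_t^2 - F = smult (- 2) (toda_cont I V g * ([:0, 1:] * w))"
    unfolding w_def F_eq by (rule toda_norm_factorization[OF g])
  have Nnz: "curve_t^2 - F \<noteq> 0" using norm_nonzero[OF nonsingular degF, of 1 curve_t] by simp
  have wnz: "w \<noteq> 0" and Dnz: "toda_cont I V g * ([:0, 1:] * w) \<noteq> 0" using Nnz unfolding N by auto
  have Xw: "[:0, 1:] * w \<noteq> 0" using Dnz by (metis mult_zero_right)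
  have on: "poly curve_t x + y = 0" if "y^2 = poly F x" "0 < order_at F curve_t 1 x y" for x y
    using order_at_pos[OF that(2)] by simp
  note o1 = h1_order(2)[OF v odd]
  have tv: "poly curve_t u + v = 0" using on[OF v] o1 False by simp
  have "order u (curve_t^2 - F) = order_at F curve_t 1 u v" using tv by (simp add: order_at_def)
  also have "order u (curve_t^2 - F) = order u (toda_cont I V g * ([:0, 1:] * w))"
    unfolding N by (rule order_smult) simp
  also have "\<dots> = order u (toda_cont I V g) + (order u [:0, 1:] + order u w)"
    unfolding order_mult[OF Dnz] order_mult[OF Xw] ..
  also have "order u (toda_cont I V g) = card {i \<in> {1..g}. u_of (P i) = u}"
    unfolding eigenvector_points_cont(1)[OF g eP] by (rule order_prod_linear) simp
  \<comment> \<open>A point P_i above u is a zero of h_1, which fixes its v-coordinate; the same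
    argument identifies A when u = 0.\<close>
  also have "{i \<in> {1..g}. u_of (P i) = u} = {i \<in> {1..g}. P i = Aff u v}"
  proof (intro equalityI subsetI)
    fix i assume i: "i \<in> {i \<in> {1..g}. u_of (P i) = u}"
    then obtain y where y: "P i = Aff u y" "y^2 = poly F u" using P_affine[of i] by auto
    have "point_count g P (Aff u y) > 0" unfolding point_count_pos using i y by force
    then have "poly curve_t u + y = 0" using on[OF y(2)] h1_order(2)[OF y(2) odd] by simp
    then have "y = v" using tv by (metis add_left_cancel)
    then show "i \<in> {i \<in> {1..g}. P i = Aff u v}" using i y by simp
  qed auto
  also have "order u [:0, 1:] = (if u = 0 then 1 else 0)" using order_linear_factor[of u 0] by simp
  also have "(u = 0) = (Aff u v = A)"
  proof
    assume u: "u = 0"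
    have "Poly_Mapping.lookup div_h1 (Aff 0 vA) \<noteq> 0" unfolding lookup_D1 by (simp add: A_eq)
    then have "Aff 0 vA \<in> curve F" by (rule keys_D1)
    then have A: "vA^2 = poly F 0" by (auto simp: curve_def)
    have "poly curve_t 0 + vA = 0" using on[OF A] h1_order(2)[OF A odd] by (simp add: A_eq)
    then have "vA = v" using tv u by (metis add_left_cancel)
    then show "Aff u v = A" using u by (simp add: A_eq)
  qed (simp add: A_eq)
  finally have w_order: "order u w = ?k" unfolding o1 by (simp add: point_count_def)
  have "fls_order_ge (int ?k) (fls_eval w U)"
    using fls_subdegree_eval_poly[OF nonsingular lp wnz] w_order
    by (auto simp: fls_order_ge_def ramification_def)
  moreover have "fls_order_ge (int ?k) (fls_eval curve_t U + fls_const 1 * W)"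
    using fls_subdegree_linear[OF nonsingular lp, of 1 curve_t] degF o1 by (simp add: fls_order_ge_def)
  ultimately have "fls_order_ge (int ?k) (fls_eval w U + (fls_eval curve_t U + fls_const 1 * W))"
    by (rule fls_order_ge_add)
  then show ?thesis by (simp add: w_def algebra_simps)
qed

lemma odd_case:
  assumes odd: "odd g"
  shows "curve F \<inter> kappa2 g I V = Q ` {1..g} \<union> Pbar ` {1..g}"
    and "\<And>u v. Aff u v \<in> curve F \<Longrightarrow> has_order F (g+1) (h2 g I V) (Aff u v)
      (Poly_Mapping.lookup ((\<Sum>i=1..g. frag_of (Q i)) + (\<Sum>i=1..g. frag_of (Pbar i))) (Aff u v))"
proof -
  let ?h = "h2_poly g I V"
  obtain a b where div: "has_divisor F (g+1) (a, b, 1) div_Q_Pbar" by (rule principal_function)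
  have n: "g + 1 > 0" by simp
  have inf: "Poly_Mapping.lookup div_Q_Pbar PInf = - int (g + 1)" "Poly_Mapping.lookup div_Q_Pbar PInf' = - int (g - 1)"
    unfolding lookup_D2 Q_not_infinite Pbar_not_infinite using odd g by simp_all
  have "has_order F (g+1) (a, b, 1) PInf (- int (g + 1))" "has_order F (g+1) (a, b, 1) PInf' (- int (g - 1))"
    using div inf unfolding has_divisor_def by (auto simp: curve_def)
  \<comment> \<open>The pole of order g + 1 at \<open>PInf\<close> is that of v, and the order g - 1
    at \<open>PInf'\<close> makes a agree with \<open>\<beta>\<close> p in degrees g and
    above.\<close>
  from pole_order_imp_linear_in_v[OF F_split monic nonzero_c n this] g
  obtain \<beta> where \<beta>: "b = [:\<beta>:]" "\<beta> \<noteq> 0" and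
    deg: "a - smult \<beta> curve_p = 0 \<or> int (degree (a - smult \<beta> curve_p)) = - (- int (g - 1))" by auto
  have ord: "has_order F (g+1) (a, [:\<beta>:], 1) (Aff u v)
      (int (point_count g Q (Aff u v)) + int (point_count g Pbar (Aff u v)))"
    if "v^2 = poly F u" for u v
    using div that \<beta>(1) unfolding has_divisor_def lookup_D2[symmetric] by (auto simp: curve_def)
  \<comment> \<open>Both a + \<open>\<beta>\<close> v and h_2 vanish along D_Q. Their combination e
    is free of v, hence divisible by a polynomial of degree g, while comparison with p bounds its
    degree below g.\<close>
  have "a = smult \<beta> ?h"
  proof (rule ccontr)
    assume "a \<noteq> smult \<beta> ?h"
    define e where "e = a - smult \<beta> ?h"
    have enz: "e \<noteq> 0" using \<open>a \<noteq> smult \<beta> ?h\<close> by (simp add: e_def)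
    have "(\<Prod>i=1..g. [:- u_of (Q i), 1:]) dvd e"
    proof (rule prod_dvd_of_vanishing[OF nonsingular degF params Q_affine])
      show "point_count g Q (Aff u v) \<le> order_at F curve_t 1 u v" if "v^2 = poly F u" for u v
        unfolding h1_order(2)[OF that odd] by simp
      fix u v assume v: "v^2 = poly F u"
      let ?k = "int (point_count g Q (Aff u v))"
      obtain U W where lp: "local_param F (g+1) (Aff u v) U W" and
        k: "fls_subdegree (fls_eval a U + fls_const \<beta> * W) = ?k + int (point_count g Pbar (Aff u v))"
        using ord[OF v] unfolding has_order_def by auto
      have ge1: "fls_order_ge ?k (fls_eval a U + fls_const \<beta> * W)" using k by (simp add: fls_order_ge_def)
      have ge2: "fls_order_ge (0 + ?k) (fls_const (- \<beta>) * (fls_eval ?h U + W))"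
        by (rule fls_order_ge_mult[OF fls_order_ge_const h2_order_ge[OF odd v lp]])
      have "fls_order_ge ?k ((fls_eval a U + fls_const \<beta> * W) + fls_const (- \<beta>) * (fls_eval ?h U + W))"
        using fls_order_ge_add[OF ge1 ge2[unfolded add_0]] .
      also have "(fls_eval a U + fls_const \<beta> * W) + fls_const (- \<beta>) * (fls_eval ?h U + W) = fls_eval e U"
        by (simp add: e_def algebra_simps)
      finally have "?k \<le> int (ramification v * order u e)"
        using fls_subdegree_eval_poly[OF nonsingular lp enz] by (simp add: fls_order_ge_def)
      then show "point_count g Q (Aff u v) \<le> ramification v * order u e" by (simp only: of_nat_le_iff)
    qed (use enz in auto)
    from dvd_imp_degree_le[OF this enz] have "g \<le> degree e" unfolding degree_prod_linear by simp
    moreover have "degree e < g"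
    proof -
      have "e = (a - smult \<beta> curve_p) - smult \<beta> (?h - curve_p)" by (simp add: e_def smult_diff_right)
      moreover have "degree (a - smult \<beta> curve_p) < g" using deg g by auto
      moreover have "degree (smult \<beta> (?h - curve_p)) < g" using degree_h2_poly_diff[OF g] \<beta>(2) by simp
      ultimately show ?thesis by (metis degree_diff_less)
    qed
    ultimately show False by simp
  qed
  \<comment> \<open>h_2 is the given function divided by the nonzero constant
    \<open>\<beta>\<close>, so it has the same orders.\<close>
  then have h2_has_order: "has_order F (g+1) (h2 g I V) (Aff u v)
      (int (point_count g Q (Aff u v)) + int (point_count g Pbar (Aff u v)))" if v: "v^2 = poly F u" for u v
  proof -
    assume a: "a = smult \<beta> ?h"
    obtain U W where lp: "local_param F (g+1) (Aff u v) U W" and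
      k: "fls_eval a U + fls_const \<beta> * W \<noteq> 0" "fls_subdegree (fls_eval a U + fls_const \<beta> * W) =
        int (point_count g Q (Aff u v)) + int (point_count g Pbar (Aff u v))"
      using ord[OF v] unfolding has_order_def by auto
    have e: "fls_eval a U + fls_const \<beta> * W = fls_const \<beta> * (fls_eval ?h U + W)"
      by (simp add: a algebra_simps)
    have "fls_eval ?h U + W \<noteq> 0" using k(1) unfolding e by auto
    moreover have "fls_subdegree (fls_eval ?h U + W) =
        int (point_count g Q (Aff u v)) + int (point_count g Pbar (Aff u v))"
      using k(2) calculation \<beta>(2) unfolding e by simp
    ultimately show ?thesis using lp unfolding has_order_def h2_def by (intro exI[of _ U] exI[of _ W]) simp
  qed
  show "has_order F (g+1) (h2 g I V) (Aff u v)
      (Poly_Mapping.lookup ((\<Sum>i=1..g. frag_of (Q i)) + (\<Sum>i=1..g. frag_of (Pbar i))) (Aff u v))"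
    if "Aff u v \<in> curve F" for u v
  proof -
    have "v^2 = poly F u" using that by (simp add: curve_def)
    from h2_has_order[OF this] show ?thesis by (simp only: lookup_add lookup_sum_frag_of)
  qed
  have zero_iff: "poly ?h u + v = 0 \<longleftrightarrow> Aff u v \<in> Q ` {1..g} \<union> Pbar ` {1..g}" if v: "v^2 = poly F u" for u v
  proof -
    obtain U W where lp: "local_param F (g+1) (Aff u v) U W" and
      k: "fls_eval ?h U + W \<noteq> 0" "fls_subdegree (fls_eval ?h U + W) =
        int (point_count g Q (Aff u v)) + int (point_count g Pbar (Aff u v))"
      using h2_has_order[OF v] unfolding has_order_def h2_def by auto
    have "poly ?h u + v = 0 \<longleftrightarrow> fls_order_ge 1 (fls_eval ?h U + W)"
      using local_param_affine_vanish[OF lp, of ?h 1] by simp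
    also have "\<dots> \<longleftrightarrow> point_count g Q (Aff u v) > 0 \<or> point_count g Pbar (Aff u v) > 0"
      using k by (auto simp: fls_order_ge_def)
    finally show ?thesis unfolding point_count_pos by blast
  qed
  show "curve F \<inter> kappa2 g I V = Q ` {1..g} \<union> Pbar ` {1..g}"
  proof (intro equalityI subsetI)
    fix R assume "R \<in> curve F \<inter> kappa2 g I V"
    then obtain u v where "R = Aff u v" "v^2 = poly F u" "poly ?h u + v = 0"
      by (auto simp: curve_def kappa2_def)
    then show "R \<in> Q ` {1..g} \<union> Pbar ` {1..g}" using zero_iff by blast
  next
    fix R assume R: "R \<in> Q ` {1..g} \<union> Pbar ` {1..g}"
    then have c: "R \<in> curve F" using Q_curve Pbar_curve by blast
    obtain u v where Ruv: "R = Aff u v" using R Q_affine Pbar_affine by blast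
    then have v: "v^2 = poly F u" using c by (simp add: curve_def)
    then show "R \<in> curve F \<inter> kappa2 g I V" using zero_iff[OF v] R c Ruv by (auto simp: kappa2_def)
  qed
qed

end

theorem theorem8:
  fixes g :: nat and I V :: "nat \<Rightarrow> complex" and P Q Pbar :: "nat \<Rightarrow> curve_point"
  defines "F \<equiv> spectral_F g I V"
  defines "A \<equiv> Aff 0 ((\<Prod>i=1..g+1. V i) - (\<Prod>i=1..g+1. I i))"
  assumes "g \<ge> 2"
    and "(I, V) \<in> phase_space g"
    and "toda_defined g I V"
    and "nonsingular_curve F"
    and "eigenvector_points g I V P"
    and "\<forall>i\<in>{1..g}. u_of (P i) \<noteq> 0" and "inj_on (\<lambda>i. u_of (P i)) {1..g}"
    and "Q ` {1..g} \<subseteq> curve F"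
    and "has_divisor F (g+1) (h1 g I V)
           ((\<Sum>i=1..g. frag_of (Q i)) + (\<Sum>i=1..g. frag_of (P i)) + frag_of A - frag_of PInf' - frag_cmul 2 (D_star g))"
    and "eigenvector_points g (toda_I g I V) (toda_V g I V) Pbar"
    and "principal_divisor F (g+1)
           ((\<Sum>i=1..g. frag_of (Q i)) + (\<Sum>i=1..g. frag_of (Pbar i)) - frag_cmul 2 (D_star g))"
  shows "(even g \<longrightarrow> (\<exists>\<sigma>. bij_betw \<sigma> {1..g} {1..g} \<and> (\<forall>i\<in>{1..g}. Pbar i = hyp_inv (Q (\<sigma> i))))) \<and>
         (odd g \<longrightarrow>
            curve F \<inter> kappa2 g I V = Q ` {1..g} \<union> Pbar ` {1..g} \<and>
            (\<forall>u v. Aff u v \<in> curve F \<longrightarrow>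
               has_order F (g+1) (h2 g I V) (Aff u v)
                 (Poly_Mapping.lookup ((\<Sum>i=1..g. frag_of (Q i)) + (\<Sum>i=1..g. frag_of (Pbar i))) (Aff u v))))"
proof -
  \<comment> \<open>Images under \<open>rho\<close> are affine, so no \<open>Pbar i\<close> lies at
    infinity.\<close>
  note Pbar_affine = eigenvector_points_cont(2)[OF assms(3) assms(12)]
  show ?thesis
    using even_case[OF assms(3,4) meta_eq_to_obj_eq[OF F_def] meta_eq_to_obj_eq[OF A_def] assms(6,7,10,11) Pbar_affine assms(13)]
      odd_case[OF assms(3,4) meta_eq_to_obj_eq[OF F_def] meta_eq_to_obj_eq[OF A_def] assms(6,7,10,11) Pbar_affine assms(13)]
    by blast
qed

end
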